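(* Assume (A2), $\mu(a,x)=\mu_1(a)+\mu_2(x)$ and $\beta(a,x)\equiv\beta(a)$ with $\beta,\mu_1\in L^\infty_+(0,a_2)$ and $\mu_2\in C_+(\overline\Omega)$. Assume $J$ is symmetric, $J(x)=J(-x)$, and that for every $D>0$ the operator $v\mapsto D\big[\int_\Omega J(\cdot-y)v(y)dy-v\big]-\mu_2v$ on $C(\overline\Omega)$ admits a principal eigenvalue. Then the function $D\mapsto s^D(\mathcal A)$ is decreasing on $(0,\infty)$.
   Context: Setting. $N\ge1$, $\Omega\subset\mathbb R^N$ bounded domain, $D>0$; $J\in C(\mathbb R^N)$ nonnegative, supported in some ball $B(0,r)$, $J(0)>0$, $\int J=1$; $\mu$ bounded below by a positive constant. Assumption (A2): there is $a_2\in(0,\hat a)$ with $\beta(a)=0$ for $a\in[a_2,\hat a)$, and $\beta$ not a.e. zero on $(0,a_2)$. $X=C(\overline\Omega)$; $K\varphi=\int_\Omega J(\cdot-y)\varphi(y)dy$. Under (A2) the operator $\mathcal A$ is the operator on $X\times L^1((0,a_2),X)$ with domain $\{0\}\times W^{1,1}((0,a_2),X)$, $\mathcal A(0,\phi)=\big(-\phi(0)+\int_0^{a_2}\beta(a,\cdot)\phi(a)da,\ -\partial_a\phi+D(K\phi-\phi)-\mu(a,\cdot)\phi\big)$; $s^D(\mathcal A)=\sup\{\mathrm{Re}\lambda:\lambda\in\sigma(\mathcal A)\}$ denotes its spectral bound as a function of $D$. A principal eigenvalue of an operator is a real eigenvalue with a positive eigenvector that is larger than the real part of every other eigenvalue.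 *)

theory Defs
  imports "HOL-Analysis.Analysis"
begin

text \<open>Complexified state space X = C(closure Omega): functions continuous on closure Omega
 (values outside closure Omega are irrelevant).\<close>

definition Xsp :: "(real^'n) set \<Rightarrow> (real^'n \<Rightarrow> complex) set" where
  "Xsp \<Omega> = {u. continuous_on (closure \<Omega>) u}"

definition supOm :: "(real^'n) set \<Rightarrow> (real^'n \<Rightarrow> complex) \<Rightarrow> real" where
  "supOm \<Omega> u = (SUP x\<in>closure \<Omega>. cmod (u x))"

text \<open>L^1((0,a2),X): (representatives of) strongly measurable X-valued functions with
 integrable norm.  Since X is separable, strong measurability is expressed through
 measurability of all point evaluations (Pettis).\<close>
definition L1sp :: "(real^'n) set \<Rightarrow> real \<Rightarrow> (real \<Rightarrow> real^'n \<Rightarrow> complex) set" where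
  "L1sp \<Omega> a2 = {g. (\<forall>a\<in>{0<..<a2}. g a \<in> Xsp \<Omega>)
     \<and> (\<forall>x\<in>closure \<Omega>. (\<lambda>a. g a x) \<in> borel_measurable (lebesgue_on {0<..<a2}))
     \<and> integral\<^sup>N (lebesgue_on {0<..<a2}) (\<lambda>a. ennreal (supOm \<Omega> (g a))) < \<infinity>}"

definition Kop :: "(real^'n \<Rightarrow> real) \<Rightarrow> (real^'n) set \<Rightarrow> (real^'n \<Rightarrow> complex) \<Rightarrow> real^'n \<Rightarrow> complex" where
  "Kop J \<Omega> u x = (LINT y|lebesgue_on \<Omega>. complex_of_real (J (x - y)) * u y)"

text \<open>phi in W^{1,1}((0,a2),X) with derivative psi (continuous representative on [0,a2]).\<close>
definition W11 :: "(real^'n) set \<Rightarrow> real \<Rightarrow> (real \<Rightarrow> real^'n \<Rightarrow> complex) \<Rightarrow> (real \<Rightarrow> real^'n \<Rightarrow> complex) \<Rightarrow> bool" where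
  "W11 \<Omega> a2 \<phi> \<psi> \<longleftrightarrow> \<psi> \<in> L1sp \<Omega> a2 \<and> (\<forall>a\<in>{0..a2}. \<phi> a \<in> Xsp \<Omega>) \<and>
     (\<forall>a\<in>{0..a2}. \<forall>x\<in>closure \<Omega>. \<phi> a x = \<phi> 0 x + (LINT s|lebesgue_on {0..a}. \<psi> s x))"

text \<open>(lambda - A)(0,phi) = (f,g), where psi = d phi / da.\<close>
definition res_eq :: "(real^'n \<Rightarrow> real) \<Rightarrow> (real^'n) set \<Rightarrow> real \<Rightarrow> (real \<Rightarrow> real^'n \<Rightarrow> real)
   \<Rightarrow> (real \<Rightarrow> real^'n \<Rightarrow> real) \<Rightarrow> real \<Rightarrow> complex \<Rightarrow> (real \<Rightarrow> real^'n \<Rightarrow> complex)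
   \<Rightarrow> (real \<Rightarrow> real^'n \<Rightarrow> complex) \<Rightarrow> (real^'n \<Rightarrow> complex) \<Rightarrow> (real \<Rightarrow> real^'n \<Rightarrow> complex) \<Rightarrow> bool" where
  "res_eq J \<Omega> D \<beta> \<mu> a2 lam \<phi> \<psi> f g \<longleftrightarrow>
     (\<forall>x\<in>closure \<Omega>. \<phi> 0 x - (LINT a|lebesgue_on {0<..<a2}. complex_of_real (\<beta> a x) * \<phi> a x) = f x) \<and>
     (AE a in lebesgue_on {0<..<a2}. \<forall>x\<in>closure \<Omega>.
        lam * \<phi> a x + \<psi> a x - complex_of_real D * (Kop J \<Omega> (\<phi> a) x - \<phi> a x)
        + complex_of_real (\<mu> a x) * \<phi> a x = g a x)"

definition in_resolvent :: "(real^'n \<Rightarrow> real) \<Rightarrow> (real^'n) set \<Rightarrow> real \<Rightarrow> (real \<Rightarrow> real^'n \<Rightarrow> real)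
   \<Rightarrow> (real \<Rightarrow> real^'n \<Rightarrow> real) \<Rightarrow> real \<Rightarrow> complex \<Rightarrow> bool" where
  "in_resolvent J \<Omega> D \<beta> \<mu> a2 lam \<longleftrightarrow>
     (\<forall>f\<in>Xsp \<Omega>. \<forall>g\<in>L1sp \<Omega> a2. \<exists>\<phi> \<psi>. W11 \<Omega> a2 \<phi> \<psi> \<and> res_eq J \<Omega> D \<beta> \<mu> a2 lam \<phi> \<psi> f g) \<and>
     (\<forall>f g \<phi>1 \<psi>1 \<phi>2 \<psi>2. W11 \<Omega> a2 \<phi>1 \<psi>1 \<and> W11 \<Omega> a2 \<phi>2 \<psi>2 \<and>
        res_eq J \<Omega> D \<beta> \<mu> a2 lam \<phi>1 \<psi>1 f g \<and> res_eq J \<Omega> D \<beta> \<mu> a2 lam \<phi>2 \<psi>2 f g \<longrightarrow>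
        (\<forall>a\<in>{0..a2}. \<forall>x\<in>closure \<Omega>. \<phi>1 a x = \<phi>2 a x)) \<and>
     (\<exists>C. \<forall>f\<in>Xsp \<Omega>. \<forall>g\<in>L1sp \<Omega> a2. \<forall>\<phi> \<psi>. W11 \<Omega> a2 \<phi> \<psi> \<and> res_eq J \<Omega> D \<beta> \<mu> a2 lam \<phi> \<psi> f g \<longrightarrow>
        integral\<^sup>N (lebesgue_on {0<..<a2}) (\<lambda>a. ennreal (supOm \<Omega> (\<phi> a)))
          \<le> ennreal C * (ennreal (supOm \<Omega> f) + integral\<^sup>N (lebesgue_on {0<..<a2}) (\<lambda>a. ennreal (supOm \<Omega> (g a)))))"

definition specA :: "(real^'n \<Rightarrow> real) \<Rightarrow> (real^'n) set \<Rightarrow> real \<Rightarrow> (real \<Rightarrow> real^'n \<Rightarrow> real)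
   \<Rightarrow> (real \<Rightarrow> real^'n \<Rightarrow> real) \<Rightarrow> real \<Rightarrow> complex set" where
  "specA J \<Omega> D \<beta> \<mu> a2 = {lam. \<not> in_resolvent J \<Omega> D \<beta> \<mu> a2 lam}"

text \<open>Spectral bound s^D(A) (in the extended reals; -infinity for empty spectrum).\<close>
definition sbound :: "(real^'n \<Rightarrow> real) \<Rightarrow> (real^'n) set \<Rightarrow> real \<Rightarrow> (real \<Rightarrow> real^'n \<Rightarrow> real)
   \<Rightarrow> (real \<Rightarrow> real^'n \<Rightarrow> real) \<Rightarrow> real \<Rightarrow> ereal" where
  "sbound J \<Omega> D \<beta> \<mu> a2 = (SUP lam\<in>specA J \<Omega> D \<beta> \<mu> a2. ereal (Re lam))"

definition Lop :: "(real^'n \<Rightarrow> real) \<Rightarrow> (real^'n) set \<Rightarrow> real \<Rightarrow> (real^'n \<Rightarrow> real)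
   \<Rightarrow> (real^'n \<Rightarrow> complex) \<Rightarrow> real^'n \<Rightarrow> complex" where
  "Lop J \<Omega> D m2 u x = complex_of_real D * (Kop J \<Omega> u x - u x) - complex_of_real (m2 x) * u x"

definition is_eigenvalue_L :: "(real^'n \<Rightarrow> real) \<Rightarrow> (real^'n) set \<Rightarrow> real \<Rightarrow> (real^'n \<Rightarrow> real) \<Rightarrow> complex \<Rightarrow> bool" where
  "is_eigenvalue_L J \<Omega> D m2 \<nu> \<longleftrightarrow> (\<exists>w\<in>Xsp \<Omega>. (\<exists>x\<in>closure \<Omega>. w x \<noteq> 0) \<and>
      (\<forall>x\<in>closure \<Omega>. Lop J \<Omega> D m2 w x = \<nu> * w x))"

definition has_principal_eigenvalue :: "(real^'n \<Rightarrow> real) \<Rightarrow> (real^'n) set \<Rightarrow> real \<Rightarrow> (real^'n \<Rightarrow> real) \<Rightarrow> bool" where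
  "has_principal_eigenvalue J \<Omega> D m2 \<longleftrightarrow> (\<exists>lam::real. \<exists>v::real^'n \<Rightarrow> real.
      continuous_on (closure \<Omega>) v \<and> (\<forall>x\<in>closure \<Omega>. 0 \<le> v x) \<and> (\<exists>x\<in>closure \<Omega>. v x \<noteq> 0) \<and>
      (\<forall>x\<in>closure \<Omega>. Lop J \<Omega> D m2 (\<lambda>y. complex_of_real (v y)) x = complex_of_real (lam * v x)) \<and>
      (\<forall>\<nu>. is_eigenvalue_L J \<Omega> D m2 \<nu> \<and> \<nu> \<noteq> complex_of_real lam \<longrightarrow> Re \<nu> < lam))"

end

theory Submission
  imports Defs
begin

text \<open>
  Let \<open>v > 0\<close> be a principal eigenvector of \<open>L\<^sub>D = D(K - 1) - \<mu>2\<close> with eigenvalue \<open>\<lambda>(D)\<close>, and let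
  \<open>F z = \<integral> \<beta>(a) exp (- z a - \<integral>\<^sub>0\<^sup>a \<mu>1) da\<close>, which is strictly decreasing and takes the value \<open>1\<close> at exactly
  one real \<open>z0\<close>. The spectral bound equals \<open>z0 + \<lambda>(D)\<close>. This number is an eigenvalue, with
  eigenfunction \<open>exp (- z0 a - \<integral>\<^sub>0\<^sup>a \<mu>1) v(x)\<close>. For \<open>l\<close> with larger real part, variation of constants turns the resolvent
  equation into an affine fixed point equation on \<open>C([0,a2] \<times> closure \<Omega>)\<close> that is a contraction for the
  supremum norm weighted by \<open>exp (- t a - \<integral>\<^sub>0\<^sup>a \<mu>1) v(x)\<close>, where \<open>z0 < t < Re l - \<lambda>(D)\<close>.

  Since \<open>J\<close> is symmetric, the Picone-type inequality \<open>\<integral> u Ku \<le> \<integral> u\<^sup>2 Kw / w\<close> holds for every \<open>w > 0\<close>. Taking for \<open>u\<close> the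
  eigenvector at \<open>D2 \<ge> D1\<close> and for \<open>w\<close> first the eigenvector at \<open>D1\<close> and then \<open>1\<close> gives
  \<open>\<lambda>(D2) \<le> \<lambda>(D1)\<close>.
\<close>

section \<open>Absolutely continuous functions on an interval\<close>

abbreviation (input) MI :: "real \<Rightarrow> real measure" where
  "MI b \<equiv> lebesgue_on {0<..<b}"

definition primitive :: "real \<Rightarrow> (real \<Rightarrow> complex) \<Rightarrow> real \<Rightarrow> complex" where
  "primitive b p a = (LINT s|MI b. (if s \<le> a then p s else 0))"

text \<open>\<open>AC b u p\<close>: \<open>u\<close> is absolutely continuous on \<open>[0,b]\<close> with almost everywhere derivative \<open>p\<close>.\<close>

definition AC :: "real \<Rightarrow> (real \<Rightarrow> complex) \<Rightarrow> (real \<Rightarrow> complex) \<Rightarrow> bool" where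
  "AC b u p \<longleftrightarrow> integrable (MI b) p \<and> (\<forall>a\<in>{0..b}. u a = u 0 + primitive b p a)"

lemma finite_measure_MI: "finite_measure (MI b)"
  by (rule finite_measure_lebesgue_on) simp

lemma ident_measurable_MI [measurable]: "(\<lambda>s. s) \<in> borel_measurable (MI b)"
  using id_borel_measurable_lebesgue_on[of "{0<..<b}"] by (simp add: id_def)

lemma AE_MI_neq: "AE s in MI b. s \<noteq> t"
proof -
  have "AE s in lebesgue. s \<noteq> t"
    by (rule AE_I[where N="{t}"]) auto
  then show ?thesis by (auto simp: AE_restrict_space_iff)
qed

lemma integrable_if_le:
  assumes "integrable (MI b) p"
  shows "integrable (MI b) (\<lambda>s. if s \<le> a then p s else (0::complex))"
proof -
  have [measurable]: "p \<in> borel_measurable (MI b)" using assms by simp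
  show ?thesis by (rule Bochner_Integration.integrable_bound[OF assms]) auto
qed

lemma primitive_0: "primitive b p 0 = 0"
proof -
  have "primitive b p 0 = (LINT s|MI b. 0)"
    unfolding primitive_def by (rule Bochner_Integration.integral_cong) auto
  then show ?thesis by simp
qed

lemma primitive_end: "primitive b p b = (LINT s|MI b. p s)"
  unfolding primitive_def by (rule Bochner_Integration.integral_cong) auto

lemma primitive_eq_integral_on:
  assumes "p \<in> borel_measurable (MI b)" "a \<in> {0..b}"
  shows "(LINT s|lebesgue_on {0..a}. p s) = primitive b p a"
proof -
  have "(\<lambda>s. if s \<in> {0<..<b} then p s else 0) \<in> borel_measurable lebesgue"
    using assms(1) by (subst borel_measurable_if) auto
  then have m1: "(\<lambda>s. if s \<in> {0..a} then (if s \<in> {0<..<b} then p s else 0) else 0) \<in> borel_measurable lebesgue"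
    by (rule measurable_If_set) auto
  have ae: "AE s in lebesgue. (if s \<in> {0..a} then (if s \<in> {0<..<b} then p s else 0) else 0) = (if s \<in> {0..a} then p s else 0)"
    by (rule AE_I[where N="{0,b}"]) (use assms(2) in \<open>auto intro: emeasure_lborel_countable\<close>)
  have m2: "(\<lambda>s. if s \<in> {0..a} then p s else 0) \<in> borel_measurable lebesgue"
  proof -
    define m where "m s = (if s \<in> {0..a} then (if s \<in> {0<..<b} then p s else 0) else 0)" for s
    have [measurable]: "m \<in> borel_measurable lebesgue" using m1 by (simp add: m_def[abs_def])
    have [measurable]: "(\<lambda>s. s) \<in> borel_measurable (lebesgue :: real measure)"
      using id_borel_measurable_lebesgue by (simp add: id_def)
    have "(\<lambda>s. if s \<in> {0..a} then p s else 0) =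
        (\<lambda>s. if s = 0 then p 0 else if s = b then (if a = b then p b else 0) else m s)"
      using assms(2) by (auto simp: m_def fun_eq_iff)
    moreover have "\<dots> \<in> borel_measurable lebesgue" by measurable
    ultimately show ?thesis by simp
  qed
  have "(LINT s|lebesgue_on {0..a}. p s) = (LINT s|lebesgue. (if s \<in> {0..a} then p s else 0))"
    by (rule Lebesgue_Measure.integral_restrict_UNIV[symmetric]) simp
  also have "\<dots> = (LINT s|lebesgue. (if s \<in> {0..a} then (if s \<in> {0<..<b} then p s else 0) else 0))"
    using ae by (intro integral_cong_AE m1 m2) auto
  also have "\<dots> = (LINT s|lebesgue. (if s \<in> {0<..<b} then (if s \<le> a then p s else 0) else 0))"
    by (rule Bochner_Integration.integral_cong) auto
  also have "\<dots> = primitive b p a"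
    unfolding primitive_def by (rule Lebesgue_Measure.integral_restrict_UNIV) simp
  finally show ?thesis .
qed

lemma continuous_on_parametric_primitive:
  fixes H :: "real \<Rightarrow> 'x::metric_space \<Rightarrow> complex"
  assumes cont: "\<And>s. s \<in> {0<..<b} \<Longrightarrow> continuous_on C (H s)"
    and meas: "\<And>x. x \<in> C \<Longrightarrow> (\<lambda>s. H s x) \<in> borel_measurable (MI b)"
    and int: "integrable (MI b) B"
    and bd: "AE s in MI b. \<forall>x\<in>C. norm (H s x) \<le> B s"
  shows "continuous_on (UNIV \<times> C) (\<lambda>(a,x). primitive b (\<lambda>s. H s x) a)"
  unfolding continuous_on_sequentially
proof (intro allI ballI impI, elim conjE)
  fix z :: "real \<times> 'x" and X :: "nat \<Rightarrow> real \<times> 'x" assume z: "z \<in> UNIV \<times> C" and X: "\<forall>n::nat. X n \<in> UNIV \<times> C" and lim: "X \<longlonglongrightarrow> z"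
  obtain a x where ax: "z = (a,x)" by (cases z)
  have x: "x \<in> C" using z ax by auto
  have Xn: "snd (X n) \<in> C" for n using X by (auto simp: mem_Times_iff)
  have la: "(\<lambda>n. fst (X n)) \<longlonglongrightarrow> a" and lx: "(\<lambda>n. snd (X n)) \<longlonglongrightarrow> x"
    using tendsto_fst[OF lim] tendsto_snd[OF lim] ax by auto
  have m[measurable]: "(\<lambda>s. H s x) \<in> borel_measurable (MI b)" by (rule meas[OF x])
  have mn[measurable]: "(\<lambda>s. H s (snd (X n))) \<in> borel_measurable (MI b)" for n by (rule meas[OF Xn])
  have "(\<lambda>n. LINT s|MI b. (if s \<le> fst (X n) then H s (snd (X n)) else 0)) \<longlonglongrightarrow> (LINT s|MI b. (if s \<le> a then H s x else 0))"
  proof (rule integral_dominated_convergence[where w="\<lambda>s. norm (B s)"])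
    show "AE s in MI b. (\<lambda>n. if s \<le> fst (X n) then H s (snd (X n)) else 0) \<longlonglongrightarrow> (if s \<le> a then H s x else 0)"
      using AE_MI_neq[of a b] AE_space
    proof eventually_elim
      case (elim s)
      have H: "(\<lambda>n. H s (snd (X n))) \<longlonglongrightarrow> H s x"
        by (rule continuous_on_tendsto_compose[OF cont lx x]) (use elim(2) Xn in auto)
      consider "s < a" | "a < s" using elim by linarith
      then show ?case
      proof cases
        case 1
        have "\<forall>\<^sub>F n in sequentially. s < fst (X n)" by (rule order_tendstoD(1)[OF la 1])
        then have "\<forall>\<^sub>F n in sequentially. H s (snd (X n)) = (if s \<le> fst (X n) then H s (snd (X n)) else 0)"
          by eventually_elim auto
        from Lim_transform_eventually[OF H this] 1 show ?thesis by simp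
      next
        case 2
        have "\<forall>\<^sub>F n in sequentially. s > fst (X n)" by (rule order_tendstoD(2)[OF la 2])
        then have "\<forall>\<^sub>F n in sequentially. (if s \<le> fst (X n) then H s (snd (X n)) else 0) = 0"
          by eventually_elim auto
        then show ?thesis using 2 by (simp add: tendsto_eventually)
      qed
    qed
    show "AE s in MI b. norm (if s \<le> fst (X n) then H s (snd (X n)) else 0) \<le> norm (B s)" for n
      using bd by eventually_elim (use Xn in \<open>auto intro: order_trans[OF _ abs_ge_self]\<close>)
    show "integrable (MI b) (\<lambda>s. norm (B s))" using int by simp
  qed measurable
  then show "((\<lambda>(a, x). primitive b (\<lambda>s. H s x) a) \<circ> X) \<longlonglongrightarrow> (case z of (a, x) \<Rightarrow> primitive b (\<lambda>s. H s x) a)"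
    by (simp add: ax primitive_def comp_def case_prod_beta)
qed

lemma continuous_on_primitive:
  assumes "integrable (MI b) p"
  shows "continuous_on S (primitive b p)"
proof -
  have "continuous_on (UNIV \<times> {0::real}) (\<lambda>(a,x). primitive b (\<lambda>s. p s) a)"
    by (rule continuous_on_parametric_primitive[where B="\<lambda>s. norm (p s)"]) (use assms in auto)
  from continuous_on_compose2[OF this, of S "\<lambda>a. (a,0)"] show ?thesis
    by (simp add: continuous_on_Pair image_subset_iff)
qed

lemma AC_integrable: "AC b u p \<Longrightarrow> integrable (MI b) p"
  unfolding AC_def by blast

lemma AC_eq: "AC b u p \<Longrightarrow> a \<in> {0..b} \<Longrightarrow> u a = u 0 + primitive b p a"
  unfolding AC_def by blast

lemma AC_I:
  "integrable (MI b) p \<Longrightarrow> (\<And>a. a \<in> {0..b} \<Longrightarrow> u a = u 0 + primitive b p a) \<Longrightarrow> AC b u p"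
  unfolding AC_def by blast

lemma AC_continuous:
  assumes "AC b u p" shows "continuous_on {0..b} u"
proof -
  have "continuous_on {0..b} (\<lambda>a. u 0 + primitive b p a)"
    by (intro continuous_intros continuous_on_primitive AC_integrable[OF assms])
  then show ?thesis
    using AC_eq[OF assms] continuous_on_cong[OF refl, of "{0..b}" u "\<lambda>a. u 0 + primitive b p a"] by blast
qed

lemma continuous_on_measurable_MI:
  fixes u :: "real \<Rightarrow> 'a::euclidean_space"
  assumes "continuous_on {0..b} u" shows "u \<in> borel_measurable (MI b)"
  by (rule continuous_imp_measurable_on_sets_lebesgue[OF continuous_on_subset[OF assms]]) auto

lemma continuous_on_compact_bound:
  fixes u :: "'x::topological_space \<Rightarrow> 'y::real_normed_vector"
  assumes "compact C" "continuous_on C u"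
  obtains B where "0 < B" "\<And>x. x \<in> C \<Longrightarrow> norm (u x) \<le> B"
  using compact_imp_bounded[OF compact_continuous_image[OF assms(2,1)]]
  unfolding bounded_pos by blast

lemma integrable_mult_continuous_MI:
  fixes u p :: "real \<Rightarrow> 'a::{euclidean_space, real_normed_field}"
  assumes "continuous_on {0..b} u" "integrable (MI b) p"
  shows "integrable (MI b) (\<lambda>s. p s * u s)"
proof -
  obtain B where B: "0 < B" "\<And>s. s \<in> {0..b} \<Longrightarrow> norm (u s) \<le> B"
    using continuous_on_compact_bound[OF compact_Icc assms(1)] by blast
  have [measurable]: "u \<in> borel_measurable (MI b)" by (rule continuous_on_measurable_MI[OF assms(1)])
  have [measurable]: "p \<in> borel_measurable (MI b)" using assms(2) by simp
  show ?thesis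
  proof (rule Bochner_Integration.integrable_bound)
    show "integrable (MI b) (\<lambda>s. B * norm (p s))" using assms by simp
    show "AE s in MI b. norm (p s * u s) \<le> norm (B * norm (p s))"
    proof (rule AE_I2)
      fix s assume "s \<in> space (MI b)"
      then have "norm (u s) \<le> \<bar>B\<bar>" using B(1) B(2)[of s] by auto
      then show "norm (p s * u s) \<le> norm (B * norm (p s))"
        by (simp add: norm_mult abs_mult mult.commute[of "\<bar>B\<bar>"] mult_left_mono)
    qed
  qed measurable
qed

text \<open>Fubini on the square \<open>[0,a]\<^sup>2\<close>, cut along its diagonal.\<close>

lemma primitive_mult:
  assumes p: "integrable (MI b) p" and q: "integrable (MI b) q"
  shows "primitive b p a * primitive b q a =
    primitive b (\<lambda>s. p s * primitive b q s) a + primitive b (\<lambda>s. q s * primitive b p s) a"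
proof -
  interpret finite_measure "MI b" by (rule finite_measure_MI)
  interpret P: pair_sigma_finite "MI b" "MI b" ..
  define p' where "p' s = (if s \<le> a then p s else 0)" for s
  define q' where "q' s = (if s \<le> a then q s else 0)" for s
  have ip: "integrable (MI b) p'" and iq: "integrable (MI b) q'"
    unfolding p'_def q'_def by (intro integrable_if_le p q)+
  have [measurable]: "p' \<in> borel_measurable (MI b)" "q' \<in> borel_measurable (MI b)"
    using ip iq by auto
  have int: "integrable (MI b \<Otimes>\<^sub>M MI b) (\<lambda>(s,t). p' s * q' t)"
  proof (rule P.Fubini_integrable)
    show "integrable (MI b) (\<lambda>s. LINT t|MI b. norm (case (s, t) of (s, t) \<Rightarrow> p' s * q' t))"
      using ip by (simp add: norm_mult)
  qed (use iq in auto)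
  define W where "W = (\<lambda>(s,t). if t \<le> s then p' s * q' t else 0)"
  define V where "V = (\<lambda>(s,t). if s < t then p' s * q' t else 0)"
  have intW: "integrable (MI b \<Otimes>\<^sub>M MI b) W"
    by (rule Bochner_Integration.integrable_bound[OF int]) (auto simp: W_def split_beta')
  have intV: "integrable (MI b \<Otimes>\<^sub>M MI b) V"
    by (rule Bochner_Integration.integrable_bound[OF int]) (auto simp: V_def split_beta')
  have pq: "primitive b q s = (LINT t|MI b. (if t \<le> s then q' t else 0))" if "s \<le> a" for s
    unfolding primitive_def by (rule Bochner_Integration.integral_cong) (use that in \<open>auto simp: q'_def\<close>)
  have pp: "primitive b p t = (LINT s|MI b. (if s < t then p' s else 0))" if "t \<le> a" for t
  proof -
    have [measurable]: "p \<in> borel_measurable (MI b)" using p by simp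
    show ?thesis unfolding primitive_def
    proof (rule integral_cong_AE)
      show "AE s in MI b. (if s \<le> t then p s else 0) = (if s < t then p' s else 0)"
        using AE_MI_neq[of t b] by eventually_elim (use that in \<open>auto simp: p'_def\<close>)
    qed measurable
  qed
  have "primitive b p a * primitive b q a = (LINT s|MI b. LINT t|MI b. p' s * q' t)"
    by (simp add: primitive_def p'_def q'_def)
  also have "\<dots> = integral\<^sup>L (MI b \<Otimes>\<^sub>M MI b) (\<lambda>(s,t). p' s * q' t)"
    using P.integral_fst'[OF int] by simp
  also have "\<dots> = integral\<^sup>L (MI b \<Otimes>\<^sub>M MI b) (\<lambda>z. W z + V z)"
    by (rule Bochner_Integration.integral_cong) (auto simp: W_def V_def)
  also have "\<dots> = integral\<^sup>L (MI b \<Otimes>\<^sub>M MI b) W + integral\<^sup>L (MI b \<Otimes>\<^sub>M MI b) V"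
    by (rule Bochner_Integration.integral_add[OF intW intV])
  also have "integral\<^sup>L (MI b \<Otimes>\<^sub>M MI b) W = (LINT s|MI b. LINT t|MI b. W (s,t))"
    using P.integral_fst'[OF intW] by simp
  also have "\<dots> = primitive b (\<lambda>s. p s * primitive b q s) a"
    unfolding primitive_def[of _ _ a]
  proof (rule Bochner_Integration.integral_cong)
    fix s
    have "(LINT t|MI b. W (s,t)) = (LINT t|MI b. p' s * (if t \<le> s then q' t else 0))"
      by (rule Bochner_Integration.integral_cong) (auto simp: W_def)
    also have "\<dots> = p' s * (LINT t|MI b. (if t \<le> s then q' t else 0))" by simp
    finally show "(LINT t|MI b. W (s,t)) = (if s \<le> a then p s * primitive b q s else 0)"
      using pq[of s] by (auto simp: p'_def)
  qed simp
  also have "integral\<^sup>L (MI b \<Otimes>\<^sub>M MI b) V = (LINT t|MI b. LINT s|MI b. V (s,t))"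
    using P.integral_snd[of "\<lambda>s t. V (s,t)"] intV by simp
  also have "\<dots> = primitive b (\<lambda>s. q s * primitive b p s) a"
    unfolding primitive_def[of _ _ a]
  proof (rule Bochner_Integration.integral_cong)
    fix t
    have "(LINT s|MI b. V (s,t)) = (LINT s|MI b. q' t * (if s < t then p' s else 0))"
      by (rule Bochner_Integration.integral_cong) (auto simp: V_def)
    also have "\<dots> = q' t * (LINT s|MI b. (if s < t then p' s else 0))" by simp
    finally show "(LINT s|MI b. V (s,t)) = (if t \<le> a then q t * primitive b p t else 0)"
      using pp[of t] by (auto simp: q'_def)
  qed simp
  finally show ?thesis .
qed

lemma primitive_add:
  assumes "integrable (MI b) p" "integrable (MI b) q"
  shows "primitive b (\<lambda>s. p s + q s) a = primitive b p a + primitive b q a"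
proof -
  have "primitive b (\<lambda>s. p s + q s) a = (LINT s|MI b. (if s \<le> a then p s else 0) + (if s \<le> a then q s else 0))"
    unfolding primitive_def by (rule Bochner_Integration.integral_cong) auto
  then show ?thesis using assms by (simp add: primitive_def integrable_if_le)
qed

lemma primitive_cmult: "primitive b (\<lambda>s. c * p s) a = c * primitive b p a"
proof -
  have "primitive b (\<lambda>s. c * p s) a = (LINT s|MI b. c * (if s \<le> a then p s else 0))"
    unfolding primitive_def by (rule Bochner_Integration.integral_cong) auto
  then show ?thesis by (simp add: primitive_def)
qed

lemma primitive_cong_AE:
  assumes [measurable]: "p \<in> borel_measurable (MI b)" "q \<in> borel_measurable (MI b)"
    and "AE s in MI b. p s = q s"
  shows "primitive b p a = primitive b q a"
  unfolding primitive_def by (rule integral_cong_AE) (use assms(3) in auto)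

lemma primitive_cong:
  assumes "\<And>s. s \<in> {0<..<b} \<Longrightarrow> p s = q s"
  shows "primitive b p a = primitive b q a"
  unfolding primitive_def by (rule Bochner_Integration.integral_cong) (use assms in auto)

lemma norm_primitive_le:
  assumes p: "integrable (MI b) p" and h: "integrable (MI b) h"
    and le: "AE s in MI b. norm (p s) \<le> h s"
  shows "norm (primitive b p a) \<le> (LINT s|MI b. (if s \<le> a then h s else 0))"
proof -
  have [measurable]: "h \<in> borel_measurable (MI b)" using h by simp
  have "norm (primitive b p a) \<le> (LINT s|MI b. norm (if s \<le> a then p s else 0))"
    unfolding primitive_def by (rule integral_norm_bound)
  also have "\<dots> \<le> (LINT s|MI b. (if s \<le> a then h s else 0))"
  proof (rule integral_mono_AE)
    show "integrable (MI b) (\<lambda>s. norm (if s \<le> a then p s else 0))"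
      using integrable_if_le[OF p] by (rule integrable_norm)
    show "integrable (MI b) (\<lambda>s. if s \<le> a then h s else 0)"
      by (rule Bochner_Integration.integrable_bound[OF h]) auto
    show "AE s in MI b. norm (if s \<le> a then p s else 0) \<le> (if s \<le> a then h s else 0)"
      using le by eventually_elim auto
  qed
  finally show ?thesis .
qed

lemma AC_mult:
  assumes u: "AC b u p" and w: "AC b w q"
  shows "AC b (\<lambda>a. u a * w a) (\<lambda>s. p s * w s + u s * q s)"
proof -
  have ip: "integrable (MI b) p" and iq: "integrable (MI b) q" using AC_integrable u w by auto
  have cu: "continuous_on {0..b} u" and cw: "continuous_on {0..b} w"
    using AC_continuous u w by auto
  have i1: "integrable (MI b) (\<lambda>s. p s * w s)" by (rule integrable_mult_continuous_MI[OF cw ip])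
  have i2: "integrable (MI b) (\<lambda>s. q s * u s)" by (rule integrable_mult_continuous_MI[OF cu iq])
  have i3: "integrable (MI b) (\<lambda>s. p s * primitive b q s)" "integrable (MI b) (\<lambda>s. q s * primitive b p s)"
    by (intro integrable_mult_continuous_MI continuous_on_primitive ip iq)+
  have eq: "u a * w a = u 0 * w 0 + primitive b (\<lambda>s. p s * w s + u s * q s) a" if a: "a \<in> {0..b}" for a
  proof -
    have "primitive b (\<lambda>s. p s * w s + u s * q s) a
       = primitive b (\<lambda>s. (w 0 * p s + p s * primitive b q s) + (u 0 * q s + q s * primitive b p s)) a"
    proof (rule primitive_cong)
      fix s assume "s \<in> {0<..<b}"
      then have "u s = u 0 + primitive b p s" "w s = w 0 + primitive b q s"
        using AC_eq[OF u, of s] AC_eq[OF w, of s] by auto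
      then show "p s * w s + u s * q s = (w 0 * p s + p s * primitive b q s) + (u 0 * q s + q s * primitive b p s)"
        by (simp add: algebra_simps)
    qed
    also have "\<dots> = w 0 * primitive b p a + u 0 * primitive b q a + primitive b p a * primitive b q a"
      by (subst primitive_add primitive_cmult, (intro Bochner_Integration.integrable_add i3 integrable_mult_right ip iq)+)+
         (simp add: primitive_cmult primitive_add i3 ip iq primitive_mult)
    finally show ?thesis
      by (subst AC_eq[OF u a], subst AC_eq[OF w a]) (simp add: algebra_simps)
  qed
  show ?thesis
    by (rule AC_I[OF _ eq]) (use i1 i2 in \<open>auto simp: mult.commute\<close>)
qed

lemma AC_const: "AC b (\<lambda>a. c) (\<lambda>s. 0)"
  by (simp add: AC_def primitive_def)

lemma AC_add: "AC b u p \<Longrightarrow> AC b w q \<Longrightarrow> AC b (\<lambda>a. u a + w a) (\<lambda>s. p s + q s)"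
proof (rule AC_I)
  fix a assume u: "AC b u p" and w: "AC b w q" and a: "a \<in> {0..b}"
  show "u a + w a = u 0 + w 0 + primitive b (\<lambda>s. p s + q s) a"
    by (subst AC_eq[OF u a], subst AC_eq[OF w a]) (simp add: primitive_add AC_integrable[OF u] AC_integrable[OF w])
qed (simp add: AC_integrable)

lemma AC_cmult: "AC b u p \<Longrightarrow> AC b (\<lambda>a. c * u a) (\<lambda>s. c * p s)"
proof (rule AC_I)
  fix a assume u: "AC b u p" and a: "a \<in> {0..b}"
  show "c * u a = c * u 0 + primitive b (\<lambda>s. c * p s) a"
    by (subst AC_eq[OF u a]) (simp add: primitive_cmult algebra_simps)
qed (simp add: AC_integrable)

lemma AC_primitive: "integrable (MI b) p \<Longrightarrow> AC b (primitive b p) p"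
  by (simp add: AC_def primitive_0)

lemma AC_cong:
  assumes "AC b u p" "\<And>a. a \<in> {0..b} \<Longrightarrow> u a = w a" "\<And>s. s \<in> {0<..<b} \<Longrightarrow> p s = q s" "b \<ge> 0"
  shows "AC b w q"
proof -
  have "integrable (MI b) q = integrable (MI b) p"
    by (rule Bochner_Integration.integrable_cong) (use assms in auto)
  moreover have "primitive b q a = primitive b p a" for a by (rule primitive_cong) (use assms in auto)
  moreover have "u 0 = w 0" using assms by simp
  ultimately show ?thesis using assms unfolding AC_def by metis
qed

lemma AC_power:
  assumes "AC b u p"
  shows "AC b (\<lambda>a. u a ^ Suc n) (\<lambda>s. of_nat (Suc n) * (p s * u s ^ n))"
proof (induction n)
  case 0 then show ?case using assms by simp
next
  case (Suc n)
  from AC_mult[OF assms Suc] show ?case by (simp add: algebra_simps)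
qed

lemma AC_exp:
  assumes u: "AC b u p"
  shows "AC b (\<lambda>a. exp (u a)) (\<lambda>s. p s * exp (u s))"
proof -
  have ip: "integrable (MI b) p" by (rule AC_integrable[OF u])
  have cu: "continuous_on {0..b} u" by (rule AC_continuous[OF u])
  have i: "integrable (MI b) (\<lambda>s. p s * exp (u s))"
    by (rule integrable_mult_continuous_MI[OF _ ip]) (intro continuous_intros cu)
  obtain B where B: "\<And>s. s \<in> {0..b} \<Longrightarrow> norm (u s) \<le> B"
    using continuous_on_compact_bound[OF compact_Icc cu] by blast
  have [measurable]: "u \<in> borel_measurable (MI b)" "p \<in> borel_measurable (MI b)"
    using continuous_on_measurable_MI[OF cu] ip by auto
  have "exp (u a) = exp (u 0) + primitive b (\<lambda>s. p s * exp (u s)) a" if a: "a \<in> {0..b}" for a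
  proof -
    define E where "E N z = (\<Sum>n<N. z ^ n /\<^sub>R fact n)" for N and z :: complex
    have Elim: "(\<lambda>N. E N z) \<longlonglongrightarrow> exp z" for z
      using exp_converges[of z] by (simp add: sums_def E_def)
    have Ebd: "norm (E N z) \<le> exp (norm z)" for N z
    proof -
      have "norm (E N z) \<le> (\<Sum>n<N. norm (z ^ n /\<^sub>R fact n))" unfolding E_def by (rule norm_sum)
      also have "\<dots> = (\<Sum>n<N. norm z ^ n /\<^sub>R fact n)" by (simp add: norm_power divide_inverse mult.commute)
      also have "\<dots> \<le> exp (norm z)"
        using sum_le_suminf[of "\<lambda>n. norm z ^ n /\<^sub>R fact n" "{..<N}"] exp_converges[of "norm z"]
        by (auto simp: sums_iff)
      finally show ?thesis .
    qed
    have step: "E (Suc N) (u a) = E (Suc N) (u 0) + primitive b (\<lambda>s. p s * E N (u s)) a" for N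
    proof (induction N)
      case 0 show ?case by (simp add: E_def primitive_def)
    next
      case (Suc N)
      have AP: "AC b (\<lambda>a. u a ^ Suc N) (\<lambda>s. of_nat (Suc N) * (p s * u s ^ N))" by (rule AC_power[OF u])
      have ES: "E (Suc n) z = E n z + z ^ n /\<^sub>R fact n" for n z by (simp add: E_def)
      have i1: "integrable (MI b) (\<lambda>s. p s * E N (u s))" unfolding E_def
        by (rule integrable_mult_continuous_MI[OF _ ip]) (intro continuous_intros cu)
      have i2: "integrable (MI b) (\<lambda>s. p s * u s ^ N)"
        by (rule integrable_mult_continuous_MI[OF _ ip]) (intro continuous_intros cu)
      have "primitive b (\<lambda>s. p s * E (Suc N) (u s)) a
         = primitive b (\<lambda>s. p s * E N (u s) + of_real (1 / fact N) * (p s * u s ^ N)) a"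
        by (rule primitive_cong) (simp add: ES algebra_simps scaleR_conv_of_real divide_inverse)
      also have "\<dots> = primitive b (\<lambda>s. p s * E N (u s)) a + of_real (1 / fact N) * primitive b (\<lambda>s. p s * u s ^ N) a"
        using i1 i2 by (simp only: primitive_add primitive_cmult integrable_mult_right)
      finally have 1: "primitive b (\<lambda>s. p s * E (Suc N) (u s)) a = \<dots>" .
      have "u a ^ Suc N = u 0 ^ Suc N + of_nat (Suc N) * primitive b (\<lambda>s. p s * u s ^ N) a"
        using AC_eq[OF AP a] by (simp only: primitive_cmult)
      then have "u a ^ Suc N /\<^sub>R fact (Suc N) = u 0 ^ Suc N /\<^sub>R fact (Suc N) + of_real (1 / fact N) * primitive b (\<lambda>s. p s * u s ^ N) a"
        by (simp add: scaleR_conv_of_real field_simps del: power_Suc of_nat_Suc)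
      then show ?case using Suc 1 by (simp add: ES[of "Suc N"] algebra_simps)
    qed
    have "(\<lambda>N. primitive b (\<lambda>s. p s * E N (u s)) a) \<longlonglongrightarrow> primitive b (\<lambda>s. p s * exp (u s)) a"
      unfolding primitive_def
    proof (rule integral_dominated_convergence[where w="\<lambda>s. norm (p s) * exp B"])
      show "integrable (MI b) (\<lambda>s. norm (p s) * exp B)" using ip by simp
      show "AE s in MI b. (\<lambda>N. if s \<le> a then p s * E N (u s) else 0) \<longlonglongrightarrow> (if s \<le> a then p s * exp (u s) else 0)"
        by (auto intro!: tendsto_intros Elim)
      show "AE s in MI b. norm (if s \<le> a then p s * E N (u s) else 0) \<le> norm (p s) * exp B" for N
      proof (rule AE_I2)
        fix s assume "s \<in> space (MI b)"
        then have "norm (E N (u s)) \<le> exp B" using Ebd[of N "u s"] B[of s] by (auto intro: order_trans)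
        then show "norm (if s \<le> a then p s * E N (u s) else 0) \<le> norm (p s) * exp B"
          by (auto simp: norm_mult intro: mult_left_mono)
      qed
    qed (unfold E_def, measurable)
    then have "(\<lambda>N. E (Suc N) (u 0) + primitive b (\<lambda>s. p s * E N (u s)) a) \<longlonglongrightarrow> exp (u 0) + primitive b (\<lambda>s. p s * exp (u s)) a"
      using LIMSEQ_Suc[OF Elim[of "u 0"]] by (intro tendsto_intros)
    then have "(\<lambda>N. E (Suc N) (u a)) \<longlonglongrightarrow> exp (u 0) + primitive b (\<lambda>s. p s * exp (u s)) a"
      by (simp only: step)
    from LIMSEQ_unique[OF LIMSEQ_Suc[OF Elim[of "u a"]] this] show ?thesis .
  qed
  then show ?thesis by (intro AC_I i)
qed

lemma linear_ode_solution:
  assumes \<phi>: "AC b \<phi> \<psi>" and \<kappa>: "AC b \<kappa> k" and k0: "\<kappa> 0 = 0"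
    and h: "h \<in> borel_measurable (MI b)" and ode: "AE s in MI b. \<psi> s = h s - k s * \<phi> s"
    and a: "a \<in> {0..b}"
  shows "\<phi> a = exp (- \<kappa> a) * (\<phi> 0 + primitive b (\<lambda>s. exp (\<kappa> s) * h s) a)"
proof -
  have m: "AC b (\<lambda>a. exp (\<kappa> a) * \<phi> a) (\<lambda>s. (k s * exp (\<kappa> s)) * \<phi> s + exp (\<kappa> s) * \<psi> s)"
    by (rule AC_mult[OF AC_exp[OF \<kappa>] \<phi>])
  have [measurable]: "\<kappa> \<in> borel_measurable (MI b)"
    by (rule continuous_on_measurable_MI[OF AC_continuous[OF \<kappa>]])
  have mm: "(\<lambda>s. (k s * exp (\<kappa> s)) * \<phi> s + exp (\<kappa> s) * \<psi> s) \<in> borel_measurable (MI b)"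
    using AC_integrable[OF m] by simp
  have "exp (\<kappa> a) * \<phi> a = \<phi> 0 + primitive b (\<lambda>s. (k s * exp (\<kappa> s)) * \<phi> s + exp (\<kappa> s) * \<psi> s) a"
    using AC_eq[OF m a] k0 by simp
  also have "primitive b (\<lambda>s. (k s * exp (\<kappa> s)) * \<phi> s + exp (\<kappa> s) * \<psi> s) a = primitive b (\<lambda>s. exp (\<kappa> s) * h s) a"
  proof (rule primitive_cong_AE[OF mm])
    show "(\<lambda>s. exp (\<kappa> s) * h s) \<in> borel_measurable (MI b)" using h by measurable
    show "AE s in MI b. (k s * exp (\<kappa> s)) * \<phi> s + exp (\<kappa> s) * \<psi> s = exp (\<kappa> s) * h s"
      using ode
    proof eventually_elim
      case (elim s)
      show ?case unfolding elim by (simp add: algebra_simps)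
    qed
  qed
  finally have "exp (- \<kappa> a) * (exp (\<kappa> a) * \<phi> a) = exp (- \<kappa> a) * (\<phi> 0 + primitive b (\<lambda>s. exp (\<kappa> s) * h s) a)"
    by (rule arg_cong)
  moreover have "exp (- \<kappa> a) * (exp (\<kappa> a) * \<phi> a) = \<phi> a"
    by (simp only: mult.assoc[symmetric] exp_add[symmetric]) simp
  ultimately show ?thesis by (simp only:)
qed

lemma linear_ode_solves:
  assumes \<kappa>: "AC b \<kappa> k" and h: "integrable (MI b) h" and b: "0 \<le> b"
    and \<phi>: "\<And>a. a \<in> {0..b} \<Longrightarrow> \<phi> a = exp (- \<kappa> a) * (c + primitive b (\<lambda>s. exp (\<kappa> s) * h s) a)"
  shows "AC b \<phi> (\<lambda>s. h s - k s * \<phi> s)"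
proof -
  have i: "integrable (MI b) (\<lambda>s. h s * exp (\<kappa> s))"
    by (intro integrable_mult_continuous_MI continuous_intros AC_continuous[OF \<kappa>] h)
  then have i: "integrable (MI b) (\<lambda>s. exp (\<kappa> s) * h s)" by (simp add: mult.commute)
  have A: "AC b (\<lambda>a. exp (- 1 * \<kappa> a) * (c + primitive b (\<lambda>s. exp (\<kappa> s) * h s) a))
      (\<lambda>s. ((- 1 * k s) * exp (- 1 * \<kappa> s)) * (c + primitive b (\<lambda>s. exp (\<kappa> s) * h s) s) + exp (- 1 * \<kappa> s) * (0 + exp (\<kappa> s) * h s))"
    by (intro AC_mult AC_exp AC_cmult AC_add AC_const AC_primitive \<kappa> i)
  show ?thesis
  proof (rule AC_cong[OF A _ _ b])
    fix s assume "s \<in> {0<..<b}"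
    then have "exp (- \<kappa> s) * (c + primitive b (\<lambda>s. exp (\<kappa> s) * h s) s) = \<phi> s" 
      by (simp only: \<phi>[of s, symmetric] greaterThanLessThan_iff atLeastAtMost_iff less_imp_le)
    moreover have "exp (- 1 * \<kappa> s) * (0 + exp (\<kappa> s) * h s) = h s" by (simp add: exp_minus field_simps)
    ultimately show "((- 1 * k s) * exp (- 1 * \<kappa> s)) * (c + primitive b (\<lambda>s. exp (\<kappa> s) * h s) s) + exp (- 1 * \<kappa> s) * (0 + exp (\<kappa> s) * h s)
       = h s - k s * \<phi> s"
      by (simp only: mult.assoc mult_minus1 mult_minus_left) simp
  qed (simp add: \<phi>)
qed

lemma primitive_of_real:
  "primitive b (\<lambda>s. complex_of_real (p s)) a = complex_of_real (LINT s|MI b. (if s \<le> a then p s else 0))"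
proof -
  have "primitive b (\<lambda>s. complex_of_real (p s)) a = (LINT s|MI b. complex_of_real (if s \<le> a then p s else 0))"
    unfolding primitive_def by (rule Bochner_Integration.integral_cong) auto
  then show ?thesis by (simp only: integral_complex_of_real)
qed

lemma primitive_const:
  assumes "a \<in> {0..b}" shows "primitive b (\<lambda>s. c) a = c * of_real a"
proof -
  have "primitive b (\<lambda>s. c) a = (LINT s|lebesgue_on {0..a}. c)"
    using assms by (intro primitive_eq_integral_on[symmetric]) auto
  then show ?thesis using assms
    by (simp add: measure_restrict_space scaleR_conv_of_real mult.commute)
qed

lemma AC_linear: "AC b (\<lambda>a. c * of_real a) (\<lambda>s. c)"
proof (rule AC_I)
  interpret finite_measure "MI b" by (rule finite_measure_MI)
  show "integrable (MI b) (\<lambda>s. c)" by simp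
qed (simp add: primitive_const)

lemma integral_exp_linear:
  fixes m :: real
  assumes "m \<noteq> 0" "a \<in> {0..b}"
  shows "(LINT s|MI b. (if s \<le> a then exp (m * s) else 0)) = (exp (m * a) - 1) / m"
proof -
  have "primitive b (\<lambda>s. complex_of_real m * exp (complex_of_real m * of_real s)) a
      = complex_of_real m * primitive b (\<lambda>s. complex_of_real (exp (m * s))) a"
    unfolding primitive_cmult by (simp add: exp_of_real flip: of_real_mult)
  also have "\<dots> = complex_of_real (m * (LINT s|MI b. (if s \<le> a then exp (m * s) else 0)))"
    by (simp only: primitive_of_real of_real_mult)
  finally have p: "primitive b (\<lambda>s. complex_of_real m * exp (complex_of_real m * of_real s)) a = \<dots>" .
  have "complex_of_real (exp (m * a)) = complex_of_real (1 + m * (LINT s|MI b. (if s \<le> a then exp (m * s) else 0)))"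
    using AC_eq[OF AC_exp[OF AC_linear[of b "complex_of_real m"]] assms(2)] unfolding p
    by (simp add: exp_of_real flip: of_real_mult)
  then have "exp (m * a) = 1 + m * (LINT s|MI b. (if s \<le> a then exp (m * s) else 0))"
    by (simp only: of_real_eq_iff)
  then show ?thesis using assms(1) by (simp add: field_simps)
qed

section \<open>The nonlocal dispersal operator\<close>

locale nonlocal_kernel =
  fixes \<Omega> :: "(real^'n) set" and J :: "real^'n \<Rightarrow> real"
  assumes open_dom: "open \<Omega>" and connected_dom: "connected \<Omega>" and bounded_dom: "bounded \<Omega>"
    and nonempty_dom: "\<Omega> \<noteq> {}"
    and J_cont: "continuous_on UNIV J" and J_nonneg: "0 \<le> J x" and J_pos: "0 < J 0"
    and J_integral: "integral\<^sup>L lebesgue J = 1" and J_sym: "J (- x) = J x"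
begin

abbreviation Cl :: "(real^'n) set" where "Cl \<equiv> closure \<Omega>"

abbreviation MO :: "(real^'n) measure" where "MO \<equiv> lebesgue_on \<Omega>"

definition Kr :: "(real^'n \<Rightarrow> real) \<Rightarrow> real^'n \<Rightarrow> real" where
  "Kr u x = (LINT y|MO. J (x - y) * u y)"

lemma compact_Cl: "compact Cl"
  using bounded_dom by (simp add: compact_closure)

lemma dom_in_Cl: "x \<in> \<Omega> \<Longrightarrow> x \<in> Cl"
  using closure_subset by auto

lemma finite_measure_MO: "finite_measure MO"
  using finite_measure_lebesgue_on[OF lmeasurable_open[OF bounded_dom open_dom]] .

lemma measurable_MO:
  fixes u :: "real^'n \<Rightarrow> 'b::euclidean_space"
  assumes "continuous_on Cl u" shows "u \<in> borel_measurable MO"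
  by (rule continuous_imp_measurable_on_sets_lebesgue[OF continuous_on_subset[OF assms closure_subset]])
     (use open_dom in auto)

lemma ident_measurable_MO [measurable]: "(\<lambda>x. x) \<in> borel_measurable MO"
  using id_borel_measurable_lebesgue_on[of \<Omega>] by (simp add: id_def)

lemma J_measurable [measurable]: "J \<in> borel_measurable borel"
  using J_cont by (simp add: borel_measurable_continuous_onI)

lemma J_shift_cont: "continuous_on S (\<lambda>y. J (x - y))"
  by (rule continuous_on_compose2[OF J_cont]) (auto intro!: continuous_intros)

lemma J_bound: obtains B where "0 < B" "\<And>x y. x \<in> Cl \<Longrightarrow> y \<in> Cl \<Longrightarrow> J (x - y) \<le> B"
proof -
  have "continuous_on (Cl \<times> Cl) (\<lambda>z. J (fst z - snd z))"
    by (rule continuous_on_compose2[OF J_cont]) (auto intro!: continuous_intros)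
  from continuous_on_compact_bound[OF compact_Times[OF compact_Cl compact_Cl] this]
  obtain B where "0 < B" "\<And>z. z \<in> Cl \<times> Cl \<Longrightarrow> norm (J (fst z - snd z)) \<le> B" by blast
  then show ?thesis by (intro that[of B]) (force simp: abs_le_iff)+
qed

lemma integrable_MO:
  fixes u :: "real^'n \<Rightarrow> 'b::euclidean_space"
  assumes "continuous_on Cl u" shows "integrable MO u"
proof -
  interpret finite_measure MO by (rule finite_measure_MO)
  obtain B where "\<And>x. x \<in> Cl \<Longrightarrow> norm (u x) \<le> B"
    using continuous_on_compact_bound[OF compact_Cl assms] by blast
  then show ?thesis
    by (intro integrable_const_bound[where B=B] AE_I2 measurable_MO assms) (auto dest: dom_in_Cl)
qed

lemma Kr_integrable:
  assumes "continuous_on Cl u" shows "integrable MO (\<lambda>y. J (x - y) * u y)"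
  by (intro integrable_MO continuous_intros J_shift_cont assms)

lemma Kop_integrable:
  assumes "continuous_on Cl u" shows "integrable MO (\<lambda>y. complex_of_real (J (x - y)) * u y)"
  by (intro integrable_MO continuous_intros J_shift_cont assms)

lemma Kop_of_real: "Kop J \<Omega> (\<lambda>y. complex_of_real (u y)) x = complex_of_real (Kr u x)"
  unfolding Kop_def Kr_def by (simp flip: integral_complex_of_real)

lemma Kop_cmult: "Kop J \<Omega> (\<lambda>y. c * u y) x = c * Kop J \<Omega> u x"
  unfolding Kop_def by (simp add: mult.left_commute)

lemma Kop_diff:
  assumes "continuous_on Cl u" "continuous_on Cl w"
  shows "Kop J \<Omega> (\<lambda>y. u y - w y) x = Kop J \<Omega> u x - Kop J \<Omega> w x"
  unfolding Kop_def using assms by (simp add: right_diff_distrib Kop_integrable)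

lemma norm_Kop_le:
  assumes "continuous_on Cl u" "continuous_on Cl w" "\<And>y. y \<in> Cl \<Longrightarrow> norm (u y) \<le> w y"
  shows "norm (Kop J \<Omega> u x) \<le> Kr w x"
  unfolding Kop_def Kr_def
proof (rule order_trans[OF integral_norm_bound])
  show "(LINT y|MO. norm (complex_of_real (J (x - y)) * u y)) \<le> (LINT y|MO. J (x - y) * w y)"
    by (rule integral_mono_AE[OF integrable_norm[OF Kop_integrable[OF assms(1)]] Kr_integrable[OF assms(2)]])
       (auto simp: norm_mult J_nonneg intro!: AE_I2 mult_left_mono assms(3) dest: dom_in_Cl)
qed

lemma Kop_continuous:
  fixes \<phi> :: "'s::metric_space \<Rightarrow> real^'n \<Rightarrow> complex"
  assumes S: "compact S" and \<phi>: "continuous_on (S \<times> Cl) (\<lambda>(a,x). \<phi> a x)"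
  shows "continuous_on (S \<times> Cl) (\<lambda>(a,x). Kop J \<Omega> (\<phi> a) x)"
  unfolding continuous_on_sequentially
proof (intro allI ballI impI, elim conjE)
  fix z :: "'s \<times> (real^'n)" and X :: "nat \<Rightarrow> 's \<times> (real^'n)"
  assume z: "z \<in> S \<times> Cl" and X: "\<forall>n. X n \<in> S \<times> Cl" and lim: "X \<longlonglongrightarrow> z"
  interpret finite_measure MO by (rule finite_measure_MO)
  obtain a x where ax: "z = (a,x)" by (cases z)
  have x: "x \<in> Cl" "a \<in> S" using z ax by auto
  have Xn: "snd (X n) \<in> Cl" "fst (X n) \<in> S" for n using X by (auto simp: mem_Times_iff)
  have la: "(\<lambda>n. fst (X n)) \<longlonglongrightarrow> a" and lx: "(\<lambda>n. snd (X n)) \<longlonglongrightarrow> x"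
    using tendsto_fst[OF lim] tendsto_snd[OF lim] ax by auto
  obtain B where B: "0 < B" "\<And>z. z \<in> S \<times> Cl \<Longrightarrow> norm (case z of (a,x) \<Rightarrow> \<phi> a x) \<le> B"
    using continuous_on_compact_bound[OF compact_Times[OF S compact_Cl] \<phi>] by blast
  obtain BJ where BJ: "0 < BJ" "\<And>x y. x \<in> Cl \<Longrightarrow> y \<in> Cl \<Longrightarrow> J (x - y) \<le> BJ" using J_bound by blast
  have slice: "continuous_on Cl (\<phi> a)" if "a \<in> S" for a
    using continuous_on_compose2[OF \<phi>, of Cl "\<lambda>y. (a,y)"] that
    by (simp add: continuous_on_Pair image_subset_iff)
  have "(\<lambda>n. LINT y|MO. complex_of_real (J (snd (X n) - y)) * \<phi> (fst (X n)) y) \<longlonglongrightarrow> (LINT y|MO. complex_of_real (J (x - y)) * \<phi> a y)"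
  proof (rule integral_dominated_convergence[where w="\<lambda>y. BJ * B"])
    show "(\<lambda>y. complex_of_real (J (x - y)) * \<phi> a y) \<in> borel_measurable MO"
      by (intro borel_measurable_integrable Kop_integrable slice x)
    show "(\<lambda>y. complex_of_real (J (snd (X n) - y)) * \<phi> (fst (X n)) y) \<in> borel_measurable MO" for n
      by (intro borel_measurable_integrable Kop_integrable slice Xn)
    show "integrable MO (\<lambda>y. BJ * B)" by simp
    show "AE y in MO. (\<lambda>n. complex_of_real (J (snd (X n) - y)) * \<phi> (fst (X n)) y) \<longlonglongrightarrow> complex_of_real (J (x - y)) * \<phi> a y"
    proof (rule AE_I2)
      fix y assume "y \<in> space MO"
      then have y: "y \<in> Cl" by (simp add: dom_in_Cl)
      have 1: "(\<lambda>n. J (snd (X n) - y)) \<longlonglongrightarrow> J (x - y)"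
        by (rule continuous_on_tendsto_compose[OF J_cont]) (auto intro!: tendsto_intros lx)
      have "(\<lambda>n. case (fst (X n), y) of (a,x) \<Rightarrow> \<phi> a x) \<longlonglongrightarrow> (case (a,y) of (a,x) \<Rightarrow> \<phi> a x)"
        by (rule continuous_on_tendsto_compose[OF \<phi>]) (use x y Xn in \<open>auto intro!: tendsto_intros la\<close>)
      then have "(\<lambda>n. \<phi> (fst (X n)) y) \<longlonglongrightarrow> \<phi> a y" by simp
      with 1 show "(\<lambda>n. complex_of_real (J (snd (X n) - y)) * \<phi> (fst (X n)) y) \<longlonglongrightarrow> complex_of_real (J (x - y)) * \<phi> a y"
        by (intro tendsto_intros)
    qed
    show "AE y in MO. norm (complex_of_real (J (snd (X n) - y)) * \<phi> (fst (X n)) y) \<le> BJ * B" for n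
    proof (rule AE_I2)
      fix y assume "y \<in> space MO"
      then have y: "y \<in> Cl" by (simp add: dom_in_Cl)
      show "norm (complex_of_real (J (snd (X n) - y)) * \<phi> (fst (X n)) y) \<le> BJ * B"
        unfolding norm_mult using BJ B(2)[of "(fst (X n), y)"] Xn y J_nonneg
        by (intro mult_mono) (auto intro: less_imp_le)
    qed
  qed
  then show "((\<lambda>(a, x). Kop J \<Omega> (\<phi> a) x) \<circ> X) \<longlonglongrightarrow> (case z of (a, x) \<Rightarrow> Kop J \<Omega> (\<phi> a) x)"
    by (simp add: ax Kop_def comp_def case_prod_beta)
qed

lemma Kop_continuous_slice:
  assumes "continuous_on Cl u" shows "continuous_on Cl (Kop J \<Omega> u)"
proof -
  have "continuous_on ({0::real} \<times> Cl) (\<lambda>(a,x). Kop J \<Omega> u x)"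
    by (rule Kop_continuous) (auto simp: case_prod_beta intro!: continuous_on_compose2[OF assms] continuous_intros)
  from continuous_on_compose2[OF this, of Cl "\<lambda>y. (0,y)"] show ?thesis
    by (simp add: continuous_on_Pair image_subset_iff)
qed

lemma Kr_continuous:
  assumes "continuous_on Cl u" shows "continuous_on Cl (Kr u)"
proof -
  have "continuous_on Cl (Kop J \<Omega> (\<lambda>y. complex_of_real (u y)))"
    by (intro Kop_continuous_slice continuous_intros assms)
  then have "continuous_on Cl (\<lambda>x. Re (complex_of_real (Kr u x)))"
    unfolding Kop_of_real by (rule continuous_on_Re)
  then show ?thesis by simp
qed

lemma Kr_1_le: "Kr (\<lambda>y. 1) x \<le> 1"
proof -
  have intJ: "integrable lebesgue J"
    using not_integrable_integral_eq[of lebesgue J] J_integral by auto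
  have lb: "integrable lborel J" "integral\<^sup>L lborel J = 1"
    using intJ J_integral by (simp_all add: integrable_completion integral_completion)
  have d: "distr lborel borel ((+) (- x)) = lborel" by (rule lborel_distr_plus)
  have e: "J (x - y) = J (- x + y)" for y using J_sym[of "x - y"] by simp
  have "integrable (distr lborel borel ((+) (- x))) J" using lb d by simp
  then have i: "integrable lborel (\<lambda>y. J (x - y))"
    unfolding e by (subst (asm) integrable_distr_eq) auto
  have v: "integral\<^sup>L lborel (\<lambda>y. J (x - y)) = 1"
    using lb(2) unfolding e by (subst (asm) d[symmetric]) (subst (asm) integral_distr, auto)
  have il: "integrable lebesgue (\<lambda>y. J (x - y))" using i by (subst integrable_completion) auto
  have vl: "integral\<^sup>L lebesgue (\<lambda>y. J (x - y)) = 1" using v by (subst integral_completion) auto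
  have "Kr (\<lambda>y. 1) x = (LINT y|lebesgue. (if y \<in> \<Omega> then J (x - y) else 0))"
    unfolding Kr_def by (subst Lebesgue_Measure.integral_restrict_UNIV) (use open_dom in auto)
  also have "\<dots> \<le> (LINT y|lebesgue. J (x - y))"
  proof (rule integral_mono_AE[OF _ il])
    show "integrable lebesgue (\<lambda>y. if y \<in> \<Omega> then J (x - y) else 0)"
      using Kr_integrable[of "\<lambda>y. 1" x] open_dom by (subst Lebesgue_Measure.integrable_restrict_UNIV) auto
  qed (auto simp: J_nonneg)
  finally show ?thesis using vl by simp
qed

text \<open>A zero of \<open>v\<close> forces \<open>v = 0\<close> on a ball of fixed radius, because \<open>J > 0\<close> near \<open>0\<close>; hence the zero set
  is open and closed in the connected set \<open>Cl\<close>.\<close>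

lemma eigenvector_pos:
  assumes v: "continuous_on Cl v" "\<And>x. x \<in> Cl \<Longrightarrow> 0 \<le> v x" "\<exists>x\<in>Cl. v x \<noteq> 0"
    and D: "0 < D" and eig: "\<And>x. x \<in> Cl \<Longrightarrow> D * Kr v x = m x * v x" and x: "x \<in> Cl"
  shows "0 < v x"
proof (rule ccontr)
  assume "\<not> 0 < v x"
  then have vx: "v x = 0" using v(2)[OF x] by simp
  define Z where "Z = {y \<in> Cl. v y = 0}"
  obtain \<delta> where \<delta>: "0 < \<delta>" "\<And>y. norm y < \<delta> \<Longrightarrow> 0 < J y"
  proof -
    have "open (J -` {0<..})" using J_cont by (auto simp: continuous_on_open_vimage)
    moreover have "0 \<in> J -` {0<..}" using J_pos by simp
    ultimately obtain \<delta> where "0 < \<delta>" "ball 0 \<delta> \<subseteq> J -` {0<..}"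
      using open_contains_ball by blast
    then show ?thesis using that[of \<delta>] by (auto simp: subset_iff)
  qed
  have step: "y \<in> Z" if z: "z \<in> Z" and y: "y \<in> Cl" and zy: "dist z y < \<delta>" for z y
  proof (rule ccontr)
    assume "y \<notin> Z"
    then have vy: "0 < v y" using v(2)[OF y] y by (auto simp: Z_def)
    obtain \<epsilon> where \<epsilon>: "0 < \<epsilon>" "\<And>w. w \<in> Cl \<Longrightarrow> dist w y < \<epsilon> \<Longrightarrow> dist (v w) (v y) < v y"
      using v(1) y vy unfolding continuous_on_iff by blast
    define r where "r = min \<epsilon> (\<delta> - dist z y)"
    have r: "0 < r" using \<epsilon> zy by (auto simp: r_def)
    have zC: "z \<in> Cl" and vz: "v z = 0" using z by (auto simp: Z_def)
    have pos: "0 < J (z - w) * v w" if "w \<in> \<Omega> \<inter> ball y r" for w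
    proof -
      have "dist y w < \<epsilon>" "dist y w < \<delta> - dist z y" using that by (auto simp: r_def)
      then have "0 < v w" using \<epsilon>(2)[of w] that dom_in_Cl by (auto simp: dist_real_def dist_commute)
      moreover have "norm (z - w) < \<delta>"
        using dist_triangle[of z w y] \<open>dist y w < \<delta> - dist z y\<close> by (simp add: dist_norm)
      ultimately show ?thesis using \<delta> by simp
    qed
    have "D * Kr v z = 0" using eig[OF zC] vz by simp
    then have "integral\<^sup>L MO (\<lambda>w. J (z - w) * v w) = 0" using D by (simp add: Kr_def)
    then have "AE w in MO. J (z - w) * v w = 0"
      by (subst (asm) integral_nonneg_eq_0_iff_AE[OF Kr_integrable[OF v(1)]])
         (auto intro!: AE_I2 mult_nonneg_nonneg J_nonneg v(2) dest: dom_in_Cl)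
    then have "AE w in lebesgue. w \<in> \<Omega> \<longrightarrow> J (z - w) * v w = 0"
      using open_dom by (subst (asm) AE_restrict_space_iff) auto
    then have "AE w in lebesgue. w \<notin> \<Omega> \<inter> ball y r"
      by eventually_elim (use pos in force)
    then have "negligible (\<Omega> \<inter> ball y r)"
      using open_dom by (simp add: negligible_iff_null_sets AE_iff_null_sets)
    moreover have "open (\<Omega> \<inter> ball y r)" using open_dom by auto
    moreover have "\<Omega> \<inter> ball y r \<noteq> {}"
    proof -
      obtain w where "w \<in> \<Omega>" "dist w y < r" using y r by (auto simp: closure_approachable)
      then show ?thesis by (auto simp: dist_commute)
    qed
    ultimately show False using open_not_negligible by blast
  qed
  have "openin (top_of_set Cl) Z"
    unfolding openin_contains_ball
  proof (intro conjI ballI)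
    show "Z \<subseteq> Cl" by (auto simp: Z_def)
    fix z assume "z \<in> Z"
    then show "\<exists>e>0. ball z e \<inter> Cl \<subseteq> Z" using step \<delta>(1) by (intro exI[of _ \<delta>]) auto
  qed
  moreover have "closedin (top_of_set Cl) Z"
    using continuous_closedin_preimage_constant[OF v(1), of 0] by (simp add: Z_def)
  ultimately have "Z = {} \<or> Z = Cl"
    using connected_imp_connected_closure[OF connected_dom] unfolding connected_clopen by blast
  then show False using vx x v(3) by (auto simp: Z_def)
qed

lemma picone:
  assumes u: "continuous_on Cl u" and w: "continuous_on Cl w" "\<And>x. x \<in> Cl \<Longrightarrow> 0 < w x"
  shows "(LINT x|MO. u x * Kr u x) \<le> (LINT x|MO. u x ^ 2 * Kr w x / w x)"
proof -
  interpret finite_measure MO by (rule finite_measure_MO)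
  interpret P: pair_sigma_finite MO MO ..
  interpret PF: finite_measure "MO \<Otimes>\<^sub>M MO"
    by (rule finite_measure_pair_measure) (rule finite_measure_MO)+
  define f where "f z = J (fst z - snd z) * (u (fst z) * u (snd z))" for z
  define g where "g z = J (fst z - snd z) * (u (fst z) ^ 2 / w (fst z) * w (snd z))" for z
  have q: "continuous_on Cl (\<lambda>x. u x ^ 2 / w x)"
    using w by (intro continuous_intros u) force+
  have [measurable]: "u \<in> borel_measurable MO" "w \<in> borel_measurable MO"
    by (intro measurable_MO u w)+
  have mf: "f \<in> borel_measurable (MO \<Otimes>\<^sub>M MO)" unfolding f_def by measurable
  have mg: "g \<in> borel_measurable (MO \<Otimes>\<^sub>M MO)" unfolding g_def by measurable
  obtain BJ where BJ: "0 < BJ" "\<And>x y. x \<in> Cl \<Longrightarrow> y \<in> Cl \<Longrightarrow> J (x - y) \<le> BJ" using J_bound by blast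
  obtain U where U: "0 < U" "\<And>x. x \<in> Cl \<Longrightarrow> norm (u x) \<le> U"
    using continuous_on_compact_bound[OF compact_Cl u] by blast
  obtain W where W: "0 < W" "\<And>x. x \<in> Cl \<Longrightarrow> norm (w x) \<le> W"
    using continuous_on_compact_bound[OF compact_Cl w(1)] by blast
  obtain Q where Q: "0 < Q" "\<And>x. x \<in> Cl \<Longrightarrow> norm (u x ^ 2 / w x) \<le> Q"
    using continuous_on_compact_bound[OF compact_Cl q] by blast
  have If: "integrable (MO \<Otimes>\<^sub>M MO) f"
  proof (rule PF.integrable_const_bound[where B="BJ * (U * U)", OF AE_I2 mf])
    fix z assume "z \<in> space (MO \<Otimes>\<^sub>M MO)"
    then have "fst z \<in> Cl" "snd z \<in> Cl" by (auto simp: space_pair_measure dom_in_Cl)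
    then show "norm (f z) \<le> BJ * (U * U)"
      unfolding f_def norm_mult using BJ U J_nonneg by (intro mult_mono) auto
  qed
  have Ig: "integrable (MO \<Otimes>\<^sub>M MO) g"
  proof (rule PF.integrable_const_bound[where B="BJ * (Q * W)", OF AE_I2 mg])
    fix z assume "z \<in> space (MO \<Otimes>\<^sub>M MO)"
    then have "fst z \<in> Cl" "snd z \<in> Cl" by (auto simp: space_pair_measure dom_in_Cl)
    then show "norm (g z) \<le> BJ * (Q * W)"
      unfolding g_def norm_mult using BJ Q W J_nonneg by (intro mult_mono) auto
  qed
  have Is: "integrable (MO \<Otimes>\<^sub>M MO) (\<lambda>(x,y). g (y,x))" by (rule P.integrable_product_swap[OF Ig])
  have Vs: "integral\<^sup>L (MO \<Otimes>\<^sub>M MO) (\<lambda>(x,y). g (y,x)) = integral\<^sup>L (MO \<Otimes>\<^sub>M MO) g"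
    by (rule P.integral_product_swap[OF mg])
  have "integral\<^sup>L (MO \<Otimes>\<^sub>M MO) (\<lambda>z. 2 * f z) \<le> integral\<^sup>L (MO \<Otimes>\<^sub>M MO) (\<lambda>z. g z + (case z of (x,y) \<Rightarrow> g (y,x)))"
  proof (rule integral_mono_AE)
    show "AE z in MO \<Otimes>\<^sub>M MO. 2 * f z \<le> g z + (case z of (x,y) \<Rightarrow> g (y,x))"
    proof (rule AE_I2)
      fix z assume "z \<in> space (MO \<Otimes>\<^sub>M MO)"
      then obtain x y where z: "z = (x,y)" and xy: "x \<in> Cl" "y \<in> Cl"
        by (cases z) (auto simp: space_pair_measure dom_in_Cl)
      have wp: "0 < w x" "0 < w y" using w(2) xy by auto
      \<comment> \<open>AM--GM: \<open>2 u(x) u(y) \<le> u(x)\<^sup>2 w(y)/w(x) + u(y)\<^sup>2 w(x)/w(y)\<close>\<close>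
      have "(u x)\<^sup>2 / w x * w y + (u y)\<^sup>2 / w y * w x - 2 * (u x * u y) = (u x * w y - u y * w x)\<^sup>2 / (w x * w y)"
        using wp by (simp add: field_simps power2_eq_square)
      then have "2 * (u x * u y) \<le> (u x)\<^sup>2 / w x * w y + (u y)\<^sup>2 / w y * w x"
        using wp by (smt (verit) divide_nonneg_pos mult_pos_pos zero_le_power2)
      then have "J (x - y) * (2 * (u x * u y)) \<le> J (x - y) * ((u x)\<^sup>2 / w x * w y + (u y)\<^sup>2 / w y * w x)"
        by (rule mult_left_mono[OF _ J_nonneg])
      moreover have "J (y - x) = J (x - y)" using J_sym[of "x - y"] by simp
      ultimately show "2 * f z \<le> g z + (case z of (x,y) \<Rightarrow> g (y,x))"
        by (simp add: z f_def g_def distrib_left)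
    qed
  qed (use If Ig Is in auto)
  also have "\<dots> = 2 * integral\<^sup>L (MO \<Otimes>\<^sub>M MO) g"
    using Ig Is Vs by simp
  finally have le: "integral\<^sup>L (MO \<Otimes>\<^sub>M MO) f \<le> integral\<^sup>L (MO \<Otimes>\<^sub>M MO) g" by simp
  have "integral\<^sup>L (MO \<Otimes>\<^sub>M MO) f = (LINT x|MO. LINT y|MO. f (x,y))"
    using P.integral_fst'[OF If] by simp
  also have "\<dots> = (LINT x|MO. u x * Kr u x)"
    unfolding Kr_def f_def by (simp add: mult.left_commute flip: integral_mult_right_zero)
  finally have 1: "integral\<^sup>L (MO \<Otimes>\<^sub>M MO) f = \<dots>" .
  have "integral\<^sup>L (MO \<Otimes>\<^sub>M MO) g = (LINT x|MO. LINT y|MO. g (x,y))"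
    using P.integral_fst'[OF Ig] by simp
  also have "\<dots> = (LINT x|MO. u x ^ 2 / w x * Kr w x)"
    unfolding Kr_def g_def by (simp add: mult.left_commute flip: integral_mult_right_zero)
  finally have 2: "integral\<^sup>L (MO \<Otimes>\<^sub>M MO) g = \<dots>" .
  show ?thesis using le 1 2 by simp
qed

lemma eigenvalue_antimono:
  assumes m: "continuous_on Cl m" and D: "0 < D1" "D1 \<le> D2"
    and v1: "continuous_on Cl v1" "\<And>x. x \<in> Cl \<Longrightarrow> 0 < v1 x"
    and v2: "continuous_on Cl v2" "\<And>x. x \<in> Cl \<Longrightarrow> 0 < v2 x"
    and e1: "\<And>x. x \<in> Cl \<Longrightarrow> D1 * Kr v1 x = (l1 + D1 + m x) * v1 x"
    and e2: "\<And>x. x \<in> Cl \<Longrightarrow> D2 * Kr v2 x = (l2 + D2 + m x) * v2 x"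
  shows "l2 \<le> l1"
proof -
  let ?u = v2
  have iu: "integrable MO (\<lambda>x. ?u x ^ 2)" by (intro integrable_MO continuous_intros v2)
  have im: "integrable MO (\<lambda>x. m x * ?u x ^ 2)" by (intro integrable_MO continuous_intros v2 m)
  have iK: "integrable MO (\<lambda>x. ?u x * Kr ?u x)" by (intro integrable_MO continuous_intros v2 Kr_continuous)
  define N where "N = (LINT x|MO. ?u x ^ 2)"
  define M where "M = (LINT x|MO. m x * ?u x ^ 2)"
  define A where "A = (LINT x|MO. ?u x * Kr ?u x)"
  have N: "0 < N"
  proof -
    have "0 \<le> N" unfolding N_def by (rule integral_nonneg_AE) auto
    moreover have "N \<noteq> 0"
    proof
      assume "N = 0"
      then have "AE x in MO. ?u x ^ 2 = 0"
        unfolding N_def by (subst (asm) integral_nonneg_eq_0_iff_AE[OF iu]) auto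
      then have "AE x in MO. False"
        using AE_space by eventually_elim (use v2(2) dom_in_Cl in fastforce)
      then have "AE x in lebesgue. x \<notin> \<Omega>"
        using open_dom by (subst (asm) AE_restrict_space_iff) auto
      then have "negligible \<Omega>"
        using open_dom by (simp add: negligible_iff_null_sets AE_iff_null_sets)
      then show False using open_not_negligible[OF open_dom nonempty_dom] by blast
    qed
    ultimately show ?thesis by simp
  qed
  have 2: "D2 * A = (l2 + D2) * N + M"
  proof -
    have "D2 * A = (LINT x|MO. D2 * (?u x * Kr ?u x))" by (simp add: A_def)
    also have "\<dots> = (LINT x|MO. (l2 + D2) * ?u x ^ 2 + m x * ?u x ^ 2)"
    proof (rule Bochner_Integration.integral_cong)
      fix x assume "x \<in> space MO"
      then have "x \<in> Cl" by (simp add: dom_in_Cl)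
      from e2[OF this] show "D2 * (?u x * Kr ?u x) = (l2 + D2) * ?u x ^ 2 + m x * ?u x ^ 2"
        by (subst mult.left_commute) (simp add: algebra_simps power2_eq_square)
    qed simp
    finally show ?thesis using iu im by (simp add: N_def M_def)
  qed
  have 1: "D1 * A \<le> (l1 + D1) * N + M"
  proof -
    have "D1 * A \<le> D1 * (LINT x|MO. ?u x ^ 2 * Kr v1 x / v1 x)"
      unfolding A_def using picone[OF v2(1) v1] D by (intro mult_left_mono) auto
    also have "\<dots> = (LINT x|MO. D1 * (?u x ^ 2 * Kr v1 x / v1 x))"
      by (rule integral_mult_right_zero[symmetric])
    also have "\<dots> = (LINT x|MO. (l1 + D1) * ?u x ^ 2 + m x * ?u x ^ 2)"
    proof (rule Bochner_Integration.integral_cong)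
      fix x assume "x \<in> space MO"
      then have x: "x \<in> Cl" by (simp add: dom_in_Cl)
      have "D1 * (?u x ^ 2 * Kr v1 x / v1 x) = ?u x ^ 2 * (D1 * Kr v1 x) / v1 x" by simp
      also have "\<dots> = (l1 + D1) * ?u x ^ 2 + m x * ?u x ^ 2"
        unfolding e1[OF x] using v1(2)[OF x] by (simp add: field_simps)
      finally show "D1 * (?u x ^ 2 * Kr v1 x / v1 x) = (l1 + D1) * ?u x ^ 2 + m x * ?u x ^ 2" .
    qed simp
    finally show ?thesis using iu im by (simp add: N_def M_def)
  qed
  have "A \<le> (LINT x|MO. ?u x ^ 2 * Kr (\<lambda>y. 1) x / 1)"
    unfolding A_def by (rule picone[OF v2(1)]) auto
  also have "\<dots> \<le> N" unfolding N_def
  proof (rule integral_mono_AE[OF _ iu])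
    show "integrable MO (\<lambda>x. ?u x ^ 2 * Kr (\<lambda>y. 1) x / 1)"
      by (intro integrable_MO continuous_intros v2 Kr_continuous) auto
    show "AE x in MO. ?u x ^ 2 * Kr (\<lambda>y. 1) x / 1 \<le> ?u x ^ 2"
      using Kr_1_le by (auto intro!: AE_I2 mult_left_le)
  qed
  finally have "(D2 - D1) * A \<le> (D2 - D1) * N" using D by (intro mult_left_mono) auto
  then have "(l2 - l1) * N \<le> 0" using 1 2 by (simp add: algebra_simps)
  then show ?thesis using N by (simp add: mult_le_0_iff)
qed

end

section \<open>Weighted contractions and the function spaces\<close>

lemma continuous_on_slice:
  assumes "continuous_on (S \<times> C) (\<lambda>(a,x). \<phi> a x)"
  shows "a \<in> S \<Longrightarrow> continuous_on C (\<phi> a)" and "x \<in> C \<Longrightarrow> continuous_on S (\<lambda>a. \<phi> a x)"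
proof -
  show "a \<in> S \<Longrightarrow> continuous_on C (\<phi> a)"
    using continuous_on_compose2[OF assms, of C "\<lambda>x. (a,x)"]
    by (simp add: continuous_on_Pair image_subset_iff)
  show "x \<in> C \<Longrightarrow> continuous_on S (\<lambda>a. \<phi> a x)"
    using continuous_on_compose2[OF assms, of S "\<lambda>a. (a,x)"]
    by (simp add: continuous_on_Pair image_subset_iff)
qed

lemma weighted_contraction_fixed_point:
  fixes T :: "('z::topological_space \<Rightarrow> complex) \<Rightarrow> 'z \<Rightarrow> complex"
  assumes K: "compact K" and \<Phi>: "continuous_on K \<Phi>" "\<And>z. z \<in> K \<Longrightarrow> 0 < \<Phi> z"
    and T: "\<And>u. continuous_on K u \<Longrightarrow> continuous_on K (T u)"
    and \<theta>: "0 \<le> \<theta>" "\<theta> < 1"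
    and contr: "\<And>u w c z. continuous_on K u \<Longrightarrow> continuous_on K w \<Longrightarrow> 0 \<le> c \<Longrightarrow>
      (\<And>z. z \<in> K \<Longrightarrow> norm (u z - w z) \<le> c * \<Phi> z) \<Longrightarrow> z \<in> K \<Longrightarrow> norm (T u z - T w z) \<le> \<theta> * c * \<Phi> z"
  shows "\<exists>u. continuous_on K u \<and> (\<forall>z\<in>K. u z = T u z)"
proof (cases "K = {}")
  case True then show ?thesis by simp
next
  case False
  obtain z0 where z0: "z0 \<in> K" "\<And>z. z \<in> K \<Longrightarrow> \<Phi> z0 \<le> \<Phi> z"
    using continuous_attains_inf[OF K False \<Phi>(1)] by blast
  have \<Phi>0: "0 < \<Phi> z0" using \<Phi>(2) z0 by blast
  obtain \<Phi>1 where \<Phi>1: "0 < \<Phi>1" "\<And>z. z \<in> K \<Longrightarrow> norm (\<Phi> z) \<le> \<Phi>1"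
    using continuous_on_compact_bound[OF K \<Phi>(1)] by blast
  have weight: "e \<le> e / \<Phi> z0 * \<Phi> z" if "z \<in> K" "0 \<le> e" for e z
  proof -
    have "e * \<Phi> z0 \<le> e * \<Phi> z" using z0(2)[OF that(1)] that(2) by (rule mult_left_mono)
    then show ?thesis using \<Phi>0 by (simp add: field_simps)
  qed
  define p where "p n = (T ^^ n) (\<lambda>z. 0)" for n
  have pS: "p (Suc n) = T (p n)" for n by (simp add: p_def)
  have pc: "continuous_on K (p n)" for n
    by (induction n) (auto simp: pS T, simp add: p_def)
  have "continuous_on K (\<lambda>z. p 1 z - p 0 z)" by (intro continuous_intros pc)
  from continuous_on_compact_bound[OF K this] obtain c0 where
    c0: "0 < c0" "\<And>z. z \<in> K \<Longrightarrow> norm (p 1 z - p 0 z) \<le> c0" by blast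
  define c where "c = c0 / \<Phi> z0"
  have c: "0 \<le> c" using c0 \<Phi>0 by (simp add: c_def)
  have step: "norm (p (Suc n) z - p n z) \<le> \<theta> ^ n * c * \<Phi> z" if "z \<in> K" for n z
    using that
  proof (induction n arbitrary: z)
    case 0
    then show ?case using c0(2)[of z] weight[of z c0] c0(1) by (simp add: c_def)
  next
    case (Suc n)
    have "norm (T (p (Suc n)) z - T (p n) z) \<le> \<theta> * (\<theta> ^ n * c) * \<Phi> z"
      by (rule contr[OF pc pc _ Suc.IH Suc.prems]) (use \<theta> c in auto)
    then show ?case by (simp add: pS mult.assoc)
  qed
  define u where "u z = (\<Sum>n. p (Suc n) z - p n z)" for z
  have "uniform_limit K (\<lambda>N z. \<Sum>n<N. p (Suc n) z - p n z) u sequentially"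
    unfolding u_def
  proof (rule Weierstrass_m_test)
    show "norm (p (Suc n) z - p n z) \<le> \<theta> ^ n * (c * \<Phi>1)" if "z \<in> K" for n z
    proof -
      have "\<theta> ^ n * c * \<Phi> z \<le> \<theta> ^ n * c * \<Phi>1"
        using \<Phi>1(2)[OF that] \<theta> c by (intro mult_left_mono) auto
      then show ?thesis using step[OF that, of n] by (simp add: mult.assoc)
    qed
    show "summable (\<lambda>n. \<theta> ^ n * (c * \<Phi>1))" using \<theta> by (intro summable_mult2 summable_geometric) auto
  qed
  moreover have "(\<lambda>N z. \<Sum>n<N. p (Suc n) z - p n z) = p"
  proof (intro ext)
    fix N z show "(\<Sum>n<N. p (Suc n) z - p n z) = p N z"
      using sum_lessThan_telescope[of "\<lambda>n. p n z" N] by (simp add: p_def[of 0])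
  qed
  ultimately have lim: "uniform_limit K p u sequentially" by simp
  have uc: "continuous_on K u"
    by (rule uniform_limit_theorem[OF _ lim]) (auto simp: pc)
  have "u z = T u z" if z: "z \<in> K" for z
  proof -
    have "norm (u z - T u z) \<le> e" if e: "0 < e" for e
    proof -
      define e' where "e' = e / (2 * (1 + \<theta> * \<Phi>1 / \<Phi> z0))"
      have den: "0 < 1 + \<theta> * \<Phi>1 / \<Phi> z0" using \<theta> \<Phi>0 \<Phi>1 by (simp add: add_pos_nonneg)
      have e': "0 < e'" using e den by (simp add: e'_def)
      obtain N where N: "\<And>n z. n \<ge> N \<Longrightarrow> z \<in> K \<Longrightarrow> dist (p n z) (u z) < e'"
        using lim e' unfolding uniform_limit_sequentially_iff by meson
      have "norm (T u z - T (p N) z) \<le> \<theta> * (e' / \<Phi> z0) * \<Phi> z"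
      proof (rule contr[OF uc pc _ _ z])
        show "norm (u w - p N w) \<le> e' / \<Phi> z0 * \<Phi> w" if "w \<in> K" for w
          using N[of N w] weight[OF that, of e'] that e' by (simp add: dist_norm norm_minus_commute)
      qed (use e' \<Phi>0 in auto)
      also have "\<dots> \<le> \<theta> * (e' / \<Phi> z0) * \<Phi>1"
        using \<Phi>1(2)[OF z] \<theta> e' \<Phi>0 by (intro mult_left_mono) auto
      finally have 1: "norm (T u z - p (Suc N) z) \<le> e' * (\<theta> * \<Phi>1 / \<Phi> z0)"
        by (simp add: pS mult.commute mult.left_commute)
      have 2: "norm (u z - p (Suc N) z) \<le> e'"
        using N[of "Suc N" z] z by (simp add: dist_norm norm_minus_commute)
      have "norm (u z - T u z) \<le> e' + e' * (\<theta> * \<Phi>1 / \<Phi> z0)"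
        using norm_triangle_ineq4[of "u z - p (Suc N) z" "T u z - p (Suc N) z"] 1 2 by simp
      also have "\<dots> = e' * (1 + \<theta> * \<Phi>1 / \<Phi> z0)" by (simp add: algebra_simps)
      also have "\<dots> = e / 2" using den unfolding e'_def by (metis less_irrefl nonzero_mult_divide_mult_cancel_right times_divide_eq_left)
      finally show ?thesis using e by simp
    qed
    then have "norm (u z - T u z) \<le> 0" by (rule field_le_epsilon[of _ 0, simplified])
    then show ?thesis by simp
  qed
  then show ?thesis using uc by blast
qed

text \<open>Apply the hypothesis at a point where \<open>norm u / \<Phi>\<close> is maximal.\<close>

lemma weighted_contraction_bound:
  fixes u :: "'z::topological_space \<Rightarrow> complex"
  assumes K: "compact K" and \<Phi>: "continuous_on K \<Phi>" "\<And>z. z \<in> K \<Longrightarrow> 0 < \<Phi> z"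
    and u: "continuous_on K u" and \<theta>: "\<theta> < 1"
    and step: "\<And>c z. 0 \<le> c \<Longrightarrow> (\<And>z. z \<in> K \<Longrightarrow> norm (u z) \<le> c * \<Phi> z) \<Longrightarrow> z \<in> K \<Longrightarrow>
      norm (u z) \<le> (r + \<theta> * c) * \<Phi> z"
    and z: "z \<in> K"
  shows "norm (u z) \<le> r / (1 - \<theta>) * \<Phi> z"
proof -
  have "continuous_on K (\<lambda>z. norm (u z) / \<Phi> z)"
    by (intro continuous_intros u \<Phi>) (use \<Phi>(2) in force)
  from continuous_attains_sup[OF K _ this] z obtain z1 where
    z1: "z1 \<in> K" "\<And>w. w \<in> K \<Longrightarrow> norm (u w) / \<Phi> w \<le> norm (u z1) / \<Phi> z1" by blast
  define c where "c = norm (u z1) / \<Phi> z1"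
  have c: "0 \<le> c" using \<Phi>(2)[OF z1(1)] by (simp add: c_def)
  have le: "norm (u w) \<le> c * \<Phi> w" if "w \<in> K" for w
    using z1(2)[OF that] \<Phi>(2)[OF that] by (simp add: c_def pos_divide_le_eq)
  have "norm (u z1) \<le> (r + \<theta> * c) * \<Phi> z1" by (rule step[OF c le z1(1)])
  then have "c \<le> r + \<theta> * c" using \<Phi>(2)[OF z1(1)] by (simp add: c_def pos_divide_le_eq)
  then have "c \<le> r / (1 - \<theta>)" using \<theta> by (simp add: pos_le_divide_eq algebra_simps)
  then have "c * \<Phi> z \<le> r / (1 - \<theta>) * \<Phi> z" using \<Phi>(2)[OF z] by (intro mult_right_mono) auto
  then show ?thesis using le[OF z] by simp
qed

context nonlocal_kernel
begin

lemma norm_le_supOm: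
  assumes "continuous_on Cl u" "x \<in> Cl" shows "norm (u x) \<le> supOm \<Omega> u"
  unfolding supOm_def
proof (rule cSUP_upper[OF assms(2)])
  obtain B where "\<And>x. x \<in> Cl \<Longrightarrow> norm (u x) \<le> B"
    using continuous_on_compact_bound[OF compact_Cl assms(1)] by blast
  then show "bdd_above ((\<lambda>x. norm (u x)) ` Cl)" by (rule bdd_aboveI2)
qed

lemma supOm_le: "(\<And>x. x \<in> Cl \<Longrightarrow> norm (u x) \<le> B) \<Longrightarrow> supOm \<Omega> u \<le> B"
  unfolding supOm_def using nonempty_dom by (intro cSUP_least) auto

lemma supOm_nonneg: "continuous_on Cl u \<Longrightarrow> 0 \<le> supOm \<Omega> u"
proof -
  assume u: "continuous_on Cl u"
  obtain x where "x \<in> Cl" using nonempty_dom dom_in_Cl by blast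
  from order_trans[OF norm_ge_zero norm_le_supOm[OF u this]] show ?thesis .
qed

lemma supOm_measurable:
  assumes "\<And>a. a \<in> {0<..<b} \<Longrightarrow> continuous_on Cl (g a)"
    and "\<And>x. x \<in> Cl \<Longrightarrow> (\<lambda>a. g a x) \<in> borel_measurable (MI b)"
  shows "(\<lambda>a. supOm \<Omega> (g a)) \<in> borel_measurable (MI b)"
proof -
  obtain T where T: "countable T" "T \<subseteq> Cl" "Cl \<subseteq> closure T"
    using separable[of Cl] by blast
  have cT: "closure T = Cl" using T closure_minimal[OF T(2)] by auto
  have Tne: "T \<noteq> {}" using T(3) nonempty_dom by auto
  have eq: "supOm \<Omega> (g a) = (SUP x\<in>T. norm (g a x))" if "a \<in> {0<..<b}" for a
  proof (rule antisym)
    have c: "continuous_on Cl (g a)" by (rule assms(1)[OF that])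
    have bdd: "bdd_above ((\<lambda>x. norm (g a x)) ` T)"
      by (rule bdd_aboveI2[where M="supOm \<Omega> (g a)"], rule norm_le_supOm[OF c]) (use T(2) in blast)
    show "supOm \<Omega> (g a) \<le> (SUP x\<in>T. norm (g a x))"
    proof (rule supOm_le)
      fix x assume x: "x \<in> Cl"
      show "norm (g a x) \<le> (SUP x\<in>T. norm (g a x))"
        by (rule continuous_le_on_closure[of T "\<lambda>x. norm (g a x)"])
           (use c x cT in \<open>auto intro!: continuous_intros cSUP_upper bdd\<close>)
    qed
    show "(SUP x\<in>T. norm (g a x)) \<le> supOm \<Omega> (g a)"
      using Tne T(2) by (intro cSUP_least norm_le_supOm[OF c]) auto
  qed
  have "(\<lambda>a. SUP x\<in>T. norm (g a x)) \<in> borel_measurable (MI b)"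
  proof (rule borel_measurable_cSUP[OF T(1)])
    show "(\<lambda>a. norm (g a x)) \<in> borel_measurable (MI b)" if "x \<in> T" for x
      using assms(2)[of x] that T(2) by auto
    show "bdd_above ((\<lambda>x. norm (g a x)) ` T)" if "a \<in> space (MI b)" for a
      by (rule bdd_aboveI2[where M="supOm \<Omega> (g a)"], rule norm_le_supOm[OF assms(1)])
         (use that T(2) in auto)
  qed
  then show ?thesis by (subst measurable_cong[where g="\<lambda>a. SUP x\<in>T. norm (g a x)"]) (auto simp: eq)
qed

lemma L1spD:
  assumes "g \<in> L1sp \<Omega> b"
  shows "\<And>a. a \<in> {0<..<b} \<Longrightarrow> continuous_on Cl (g a)"
    and "\<And>x. x \<in> Cl \<Longrightarrow> (\<lambda>a. g a x) \<in> borel_measurable (MI b)"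
    and "integrable (MI b) (\<lambda>a. supOm \<Omega> (g a))"
    and "\<And>x. x \<in> Cl \<Longrightarrow> integrable (MI b) (\<lambda>a. g a x)"
    and "(\<integral>\<^sup>+a. ennreal (supOm \<Omega> (g a)) \<partial>MI b) = ennreal (LINT a|MI b. supOm \<Omega> (g a))"
proof -
  show c: "\<And>a. a \<in> {0<..<b} \<Longrightarrow> continuous_on Cl (g a)"
    and m: "\<And>x. x \<in> Cl \<Longrightarrow> (\<lambda>a. g a x) \<in> borel_measurable (MI b)"
    using assms by (auto simp: L1sp_def Xsp_def)
  show i: "integrable (MI b) (\<lambda>a. supOm \<Omega> (g a))"
  proof (rule integrableI_nonneg[OF supOm_measurable[OF c m]])
    show "AE a in MI b. 0 \<le> supOm \<Omega> (g a)" using c supOm_nonneg by (intro AE_I2) auto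
    show "(\<integral>\<^sup>+a. ennreal (supOm \<Omega> (g a)) \<partial>MI b) < \<infinity>" using assms by (simp add: L1sp_def)
  qed
  show "integrable (MI b) (\<lambda>a. g a x)" if x: "x \<in> Cl" for x
    by (rule Bochner_Integration.integrable_bound[OF i m[OF x]])
       (intro AE_I2, use norm_le_supOm[OF c x] in force)
  show "(\<integral>\<^sup>+a. ennreal (supOm \<Omega> (g a)) \<partial>MI b) = ennreal (LINT a|MI b. supOm \<Omega> (g a))"
    by (rule nn_integral_eq_integral[OF i]) (use c supOm_nonneg in \<open>auto intro!: AE_I2\<close>)
qed

lemma L1spI:
  assumes "\<And>a. a \<in> {0<..<b} \<Longrightarrow> continuous_on Cl (g a)"
    and "\<And>x. x \<in> Cl \<Longrightarrow> (\<lambda>a. g a x) \<in> borel_measurable (MI b)"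
    and "integrable (MI b) B" and "AE a in MI b. \<forall>x\<in>Cl. norm (g a x) \<le> B a"
  shows "g \<in> L1sp \<Omega> b"
proof -
  have "(\<integral>\<^sup>+a. ennreal (supOm \<Omega> (g a)) \<partial>MI b) \<le> (\<integral>\<^sup>+a. ennreal (norm (B a)) \<partial>MI b)"
  proof (rule nn_integral_mono_AE)
    show "AE a in MI b. ennreal (supOm \<Omega> (g a)) \<le> ennreal (norm (B a))"
      using assms(4)
    proof eventually_elim
      case (elim a)
      have "supOm \<Omega> (g a) \<le> B a" by (rule supOm_le) (use elim in blast)
      then show ?case by (intro ennreal_leI) simp
    qed
  qed
  also have "\<dots> < \<infinity>" using assms(3) by (simp add: integrable_iff_bounded)
  finally show ?thesis using assms by (auto simp: L1sp_def Xsp_def)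
qed

lemma W11_AC:
  assumes "W11 \<Omega> b \<phi> \<psi>" "x \<in> Cl"
  shows "AC b (\<lambda>a. \<phi> a x) (\<lambda>s. \<psi> s x)"
proof (rule AC_I)
  have L: "\<psi> \<in> L1sp \<Omega> b" using assms(1) unfolding W11_def by (elim conjE)
  show "integrable (MI b) (\<lambda>s. \<psi> s x)" by (rule L1spD(4)[OF L assms(2)])
  fix a assume a: "a \<in> {0..b}"
  show "\<phi> a x = \<phi> 0 x + primitive b (\<lambda>s. \<psi> s x) a"
    unfolding primitive_eq_integral_on[OF L1spD(2)[OF L assms(2)] a, symmetric]
    using assms(1)[unfolded W11_def, THEN conjunct2, THEN conjunct2, rule_format, OF a assms(2)] .
qed

lemma W11_I:
  assumes "\<psi> \<in> L1sp \<Omega> b" "\<And>a. a \<in> {0..b} \<Longrightarrow> continuous_on Cl (\<phi> a)"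
    and "\<And>x. x \<in> Cl \<Longrightarrow> AC b (\<lambda>a. \<phi> a x) (\<lambda>s. \<psi> s x)"
  shows "W11 \<Omega> b \<phi> \<psi>"
  unfolding W11_def
proof (intro conjI ballI)
  fix a x assume a: "a \<in> {0..b}" and x: "x \<in> Cl"
  show "\<phi> a x = \<phi> 0 x + (LINT s|lebesgue_on {0..a}. \<psi> s x)"
    unfolding primitive_eq_integral_on[OF L1spD(2)[OF assms(1) x] a] by (rule AC_eq[OF assms(3)[OF x] a])
qed (use assms in \<open>auto simp: Xsp_def\<close>)

lemma W11_continuous:
  assumes "W11 \<Omega> b \<phi> \<psi>" "0 \<le> b"
  shows "continuous_on ({0..b} \<times> Cl) (\<lambda>(a,x). \<phi> a x)"
proof -
  have L: "\<psi> \<in> L1sp \<Omega> b" using assms(1) unfolding W11_def by (elim conjE)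
  have 0: "continuous_on Cl (\<phi> 0)" using assms(1)[unfolded W11_def, THEN conjunct2, THEN conjunct1] assms(2) by (simp add: Xsp_def)
  have "continuous_on (UNIV \<times> Cl) (\<lambda>(a,x). primitive b (\<lambda>s. \<psi> s x) a)"
    by (rule continuous_on_parametric_primitive[OF L1spD(1)[OF L] L1spD(2)[OF L] L1spD(3)[OF L]])
       (auto intro!: AE_I2 norm_le_supOm L1spD(1)[OF L])
  then have "continuous_on ({0..b} \<times> Cl) (\<lambda>z. \<phi> 0 (snd z) + (\<lambda>(a,x). primitive b (\<lambda>s. \<psi> s x) a) z)"
    by (intro continuous_on_add continuous_on_compose2[OF 0, of _ snd] continuous_on_snd continuous_on_id)
       (auto intro: continuous_on_subset[of "UNIV \<times> Cl"])
  then show ?thesis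
  proof (rule continuous_on_eq)
    fix z assume "z \<in> {0..b} \<times> Cl"
    then obtain a x where z: "z = (a,x)" "a \<in> {0..b}" "x \<in> Cl" by blast
    show "\<phi> 0 (snd z) + (case z of (a,x) \<Rightarrow> primitive b (\<lambda>s. \<psi> s x) a) = (case z of (a,x) \<Rightarrow> \<phi> a x)"
      using AC_eq[OF W11_AC[OF assms(1) z(3)] z(2)] unfolding z(1) by (simp only: prod.case snd_conv)
  qed
qed

end

section \<open>The characteristic function\<close>

locale age_model = nonlocal_kernel \<Omega> J for \<Omega> :: "(real^'n) set" and J +
  fixes \<beta> \<mu>1 :: "real \<Rightarrow> real" and \<mu>2 :: "real^'n \<Rightarrow> real" and a2 M\<beta> M\<mu> :: real
  assumes a2_pos: "0 < a2"
    and \<beta>_nontrivial: "\<not> (AE a in MI a2. \<beta> a = 0)"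
    and \<beta>_measurable [measurable]: "\<beta> \<in> borel_measurable (MI a2)"
    and \<beta>_bounds: "AE a in MI a2. 0 \<le> \<beta> a \<and> \<beta> a \<le> M\<beta>"
    and \<mu>1_measurable [measurable]: "\<mu>1 \<in> borel_measurable (MI a2)"
    and \<mu>1_bounds: "AE a in MI a2. 0 \<le> \<mu>1 a \<and> \<mu>1 a \<le> M\<mu>"
    and \<mu>2_cont: "continuous_on Cl \<mu>2"
begin

text \<open>\<open>RM\<close> is the cumulative mortality \<open>\<integral>\<^sub>0\<^sup>a \<mu>1\<close>.\<close>

definition RM :: "real \<Rightarrow> real" where
  "RM a = (LINT s|MI a2. (if s \<le> a then \<mu>1 s else 0))"

definition F :: "real \<Rightarrow> real" where
  "F z = (LINT a|MI a2. \<beta> a * exp (- z * a - RM a))"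

lemma \<beta>_integrable: "integrable (MI a2) \<beta>"
proof -
  interpret finite_measure "MI a2" by (rule finite_measure_MI)
  show ?thesis
    by (rule integrable_const_bound[where B="M\<beta>"]) (use \<beta>_bounds in auto)
qed

lemma \<mu>1_integrable: "integrable (MI a2) \<mu>1"
proof -
  interpret finite_measure "MI a2" by (rule finite_measure_MI)
  show ?thesis
    by (rule integrable_const_bound[where B="M\<mu>"]) (use \<mu>1_bounds in auto)
qed

lemma AC_RM: "AC a2 (\<lambda>a. complex_of_real (RM a)) (\<lambda>s. complex_of_real (\<mu>1 s))"
  unfolding RM_def primitive_of_real[symmetric]
  by (rule AC_primitive) (simp add: \<mu>1_integrable)

lemma RM_0: "RM 0 = 0"
proof -
  have "complex_of_real (RM 0) = 0"
    unfolding RM_def primitive_of_real[symmetric] by (rule primitive_0)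
  then show ?thesis by simp
qed

lemma RM_continuous: "continuous_on {0..a2} RM"
  using continuous_on_Re[OF AC_continuous[OF AC_RM]] by simp

lemma RM_nonneg: "0 \<le> RM a"
  unfolding RM_def
proof (rule integral_nonneg_AE)
  show "AE s in MI a2. 0 \<le> (if s \<le> a then \<mu>1 s else 0)"
    using \<mu>1_bounds by eventually_elim auto
qed

lemma F_integrable: "integrable (MI a2) (\<lambda>a. \<beta> a * exp (- z * a - RM a))"
  by (intro integrable_mult_continuous_MI \<beta>_integrable continuous_intros RM_continuous)

lemma F_continuous: "continuous_on S F"
proof -
  have "continuous_on UNIV F"
    unfolding continuous_on_sequentially
  proof (intro allI ballI impI, elim conjE)
    fix z :: real and X :: "nat \<Rightarrow> real" assume X: "X \<longlonglongrightarrow> z"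
    obtain B where B: "0 < B" "\<And>n. norm (X n) \<le> B"
      using Bseq_def[of X] convergent_imp_Bseq[OF convergentI[OF X]] by blast
    have [measurable]: "RM \<in> borel_measurable (MI a2)"
      by (rule continuous_on_measurable_MI[OF RM_continuous])
    have "(\<lambda>n. F (X n)) \<longlonglongrightarrow> F z"
      unfolding F_def
    proof (rule integral_dominated_convergence[where w="\<lambda>a. norm (\<beta> a) * exp (B * a2)"])
      show "integrable (MI a2) (\<lambda>a. norm (\<beta> a) * exp (B * a2))" using \<beta>_integrable by simp
      show "AE a in MI a2. (\<lambda>n. \<beta> a * exp (- X n * a - RM a)) \<longlonglongrightarrow> \<beta> a * exp (- z * a - RM a)"
        by (intro AE_I2 tendsto_intros X)
      show "AE a in MI a2. norm (\<beta> a * exp (- X n * a - RM a)) \<le> norm (\<beta> a) * exp (B * a2)" for n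
      proof (rule AE_I2)
        fix a assume "a \<in> space (MI a2)"
        then have a: "0 < a" "a < a2" by auto
        have "- X n * a \<le> B * a2" using B(2)[of n] a B(1) by (intro mult_mono) auto
        then have "- X n * a - RM a \<le> B * a2" using RM_nonneg[of a] by linarith
        then have "exp (- X n * a - RM a) \<le> exp (B * a2)" by simp
        then show "norm (\<beta> a * exp (- X n * a - RM a)) \<le> norm (\<beta> a) * exp (B * a2)"
          unfolding norm_mult by (intro mult_left_mono) auto
      qed
    qed measurable
    then show "(F \<circ> X) \<longlonglongrightarrow> F z" by (simp add: comp_def)
  qed
  then show ?thesis by (rule continuous_on_subset) simp
qed

lemma F_strict_antimono:
  assumes "z < z'" shows "F z' < F z"
proof -
  define d where "d a = \<beta> a * exp (- z * a - RM a) - \<beta> a * exp (- z' * a - RM a)" for a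
  have di: "integrable (MI a2) d" unfolding d_def by (intro Bochner_Integration.integrable_diff F_integrable)
  have d_eq: "d a = \<beta> a * (exp (- z * a - RM a) - exp (- z' * a - RM a))" for a
    by (simp add: d_def right_diff_distrib)
  have pos: "0 < exp (- z * a - RM a) - exp (- z' * a - RM a)" if "a \<in> {0<..<a2}" for a
    using assms that by simp
  have dn: "AE a in MI a2. 0 \<le> d a"
    using \<beta>_bounds AE_space
  proof eventually_elim
    case (elim a)
    show ?case unfolding d_eq using elim pos[of a] by (intro mult_nonneg_nonneg) auto
  qed
  have "integral\<^sup>L (MI a2) d \<noteq> 0"
  proof
    assume "integral\<^sup>L (MI a2) d = 0"
    then have "AE a in MI a2. d a = 0" using integral_nonneg_eq_0_iff_AE[OF di dn] by simp
    then have "AE a in MI a2. \<beta> a = 0"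
      using AE_space
    proof eventually_elim
      case (elim a) then show ?case using pos[of a] by (simp add: d_eq)
    qed
    then show False using \<beta>_nontrivial by blast
  qed
  moreover have "0 \<le> integral\<^sup>L (MI a2) d" by (rule integral_nonneg_AE[OF dn])
  moreover have "integral\<^sup>L (MI a2) d = F z - F z'"
    unfolding d_def F_def by (intro Bochner_Integration.integral_diff F_integrable)
  ultimately show ?thesis by simp
qed

lemma F_eq_1: obtains z0 where "F z0 = 1"
proof -
  define G where "G = (LINT a|MI a2. \<beta> a * (a * exp (- RM a)))"
  have Gi: "integrable (MI a2) (\<lambda>a. \<beta> a * (a * exp (- RM a)))"
    by (intro integrable_mult_continuous_MI \<beta>_integrable continuous_intros RM_continuous)
  have Gn: "AE a in MI a2. 0 \<le> \<beta> a * (a * exp (- RM a))"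
    using \<beta>_bounds AE_space by eventually_elim auto
  have "G \<noteq> 0"
  proof
    assume "G = 0"
    then have "AE a in MI a2. \<beta> a * (a * exp (- RM a)) = 0"
      using integral_nonneg_eq_0_iff_AE[OF Gi Gn] by (simp add: G_def)
    then have "AE a in MI a2. \<beta> a = 0" using AE_space by eventually_elim auto
    then show False using \<beta>_nontrivial by blast
  qed
  then have G: "0 < G" using integral_nonneg_AE[OF Gn] by (simp add: G_def)
  have lo: "1 \<le> F (- (1 / G))"
  proof -
    have "1 = (LINT a|MI a2. 1 / G * (\<beta> a * (a * exp (- RM a))))"
      unfolding integral_mult_right_zero G_def[symmetric] using G by simp
    also have "\<dots> \<le> F (- (1 / G))"
      unfolding F_def
    proof (rule integral_mono_AE[OF _ F_integrable])
      show "AE a in MI a2. 1 / G * (\<beta> a * (a * exp (- RM a))) \<le> \<beta> a * exp (- (- (1 / G)) * a - RM a)"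
        using \<beta>_bounds
      proof eventually_elim
        case (elim a)
        have "1 / G * a \<le> exp (1 / G * a)" using exp_ge_add_one_self[of "1 / G * a"] by linarith
        then have "\<beta> a * (1 / G * a * exp (- RM a)) \<le> \<beta> a * (exp (1 / G * a) * exp (- RM a))"
          using elim by (intro mult_left_mono mult_right_mono) auto
        then show ?case by (simp add: exp_diff exp_minus divide_inverse mult_ac)
      qed
    qed (use Gi in simp)
    finally show ?thesis .
  qed
  define Z where "Z = \<bar>M\<beta>\<bar> + 1"
  have Z: "0 < Z" by (simp add: Z_def)
  have hi: "F Z \<le> 1"
  proof -
    have e: "integrable (MI a2) (\<lambda>a. (if a \<le> a2 then exp (- Z * a) else 0))"
      by (rule finite_measure.integrable_const_bound[OF finite_measure_MI, where B=1])
         (use Z in \<open>auto intro!: AE_I2\<close>)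
    have "F Z \<le> (LINT a|MI a2. \<bar>M\<beta>\<bar> * (if a \<le> a2 then exp (- Z * a) else 0))"
      unfolding F_def
    proof (rule integral_mono_AE[OF F_integrable])
      show "AE a in MI a2. \<beta> a * exp (- Z * a - RM a) \<le> \<bar>M\<beta>\<bar> * (if a \<le> a2 then exp (- Z * a) else 0)"
        using \<beta>_bounds AE_space
      proof eventually_elim
        case (elim a)
        have "exp (- Z * a - RM a) \<le> exp (- Z * a)" using RM_nonneg[of a] by simp
        then have "\<beta> a * exp (- Z * a - RM a) \<le> \<bar>M\<beta>\<bar> * exp (- Z * a)"
          using elim by (intro mult_mono) auto
        then show ?case using elim by simp
      qed
    qed (use e in simp)
    also have "\<dots> = \<bar>M\<beta>\<bar> * ((exp (- Z * a2) - 1) / (- Z))"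
      unfolding integral_mult_right_zero by (subst integral_exp_linear) (use Z a2_pos in auto)
    also have "\<dots> = \<bar>M\<beta>\<bar> * (1 - exp (- Z * a2)) / Z" using Z by (simp add: field_simps)
    also have "\<dots> \<le> \<bar>M\<beta>\<bar> * 1 / Z" using Z by (intro divide_right_mono mult_left_mono) auto
    also have "\<dots> \<le> 1" using Z by (simp add: Z_def)
    finally show ?thesis .
  qed
  have "- (1 / G) \<le> Z" using Z G by (smt (verit) divide_pos_pos)
  from IVT2'[of F Z 1 "- (1 / G)", OF hi lo this F_continuous] show ?thesis using that by blast
qed

end

section \<open>The equation as a fixed point problem\<close>

locale age_model_eigen = age_model \<Omega> J \<beta> \<mu>1 \<mu>2 a2 M\<beta> M\<mu>
  for \<Omega> :: "(real^'n) set" and J \<beta> \<mu>1 \<mu>2 a2 M\<beta> M\<mu> +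
  fixes D lp :: real and v :: "real^'n \<Rightarrow> real"
  assumes D_pos: "0 < D" and v_cont: "continuous_on Cl v" and v_pos: "\<And>x. x \<in> Cl \<Longrightarrow> 0 < v x"
    and v_eigen: "\<And>x. x \<in> Cl \<Longrightarrow> D * Kr v x = (lp + D + \<mu>2 x) * v x"
begin

abbreviation jc :: "(real \<Rightarrow> real^'n \<Rightarrow> 'b::real_normed_vector) \<Rightarrow> bool" where
  "jc \<phi> \<equiv> continuous_on ({0..a2} \<times> Cl) (\<lambda>(a,x). \<phi> a x)"

text \<open>Variation of constants with integrating factor \<open>exp (kap l a x)\<close> rewrites \<open>(l - A)(0,\<phi>) = (f,g)\<close>
  as \<open>\<phi> = Rop l f g + Sop l \<phi>\<close>. Only the nonlocal gain term stays in \<open>Sop\<close>, so that \<open>Sop\<close> is positive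
  for real \<open>l\<close>.\<close>

definition kap :: "complex \<Rightarrow> real \<Rightarrow> real^'n \<Rightarrow> complex" where
  "kap l a x = (l + of_real (D + \<mu>2 x)) * of_real a + of_real (RM a)"

definition Sop :: "complex \<Rightarrow> (real \<Rightarrow> real^'n \<Rightarrow> complex) \<Rightarrow> real \<Rightarrow> real^'n \<Rightarrow> complex" where
  "Sop l \<phi> a x = exp (- kap l a x) * (primitive a2 (\<lambda>s. of_real (\<beta> s) * \<phi> s x) a2
     + primitive a2 (\<lambda>s. exp (kap l s x) * (of_real D * Kop J \<Omega> (\<phi> s) x)) a)"

definition Rop :: "complex \<Rightarrow> (real^'n \<Rightarrow> complex) \<Rightarrow> (real \<Rightarrow> real^'n \<Rightarrow> complex) \<Rightarrow> real \<Rightarrow> real^'n \<Rightarrow> complex" where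
  "Rop l f g a x = exp (- kap l a x) * (f x + primitive a2 (\<lambda>s. exp (kap l s x) * g s x) a)"

lemma compact_dom: "compact ({0..a2} \<times> Cl)"
  by (intro compact_Times compact_Cl compact_Icc)

lemma jc_mult: "jc f \<Longrightarrow> jc g \<Longrightarrow> jc (\<lambda>a x. f a x * (g a x :: complex))"
  by (simp add: case_prod_beta continuous_on_mult)

lemma jc_add: "jc f \<Longrightarrow> jc g \<Longrightarrow> jc (\<lambda>a x. f a x + (g a x :: complex))"
  by (simp add: case_prod_beta continuous_on_add)

lemma jc_diff: "jc f \<Longrightarrow> jc g \<Longrightarrow> jc (\<lambda>a x. f a x - (g a x :: complex))"
  by (simp add: case_prod_beta continuous_on_diff)

lemma jc_snd: "continuous_on Cl f \<Longrightarrow> jc (\<lambda>a x. f x)"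
  unfolding case_prod_beta
  by (rule continuous_on_compose2[of Cl f _ snd]) (auto intro!: continuous_intros)

lemma jc_fst: "continuous_on {0..a2} f \<Longrightarrow> jc (\<lambda>a x. f a)"
  unfolding case_prod_beta
  by (rule continuous_on_compose2[of "{0..a2}" f _ fst]) (auto intro!: continuous_intros)

lemma jc_bound:
  assumes "jc \<phi>"
  obtains B where "0 < B" "\<And>a x. a \<in> {0..a2} \<Longrightarrow> x \<in> Cl \<Longrightarrow> norm (\<phi> a x) \<le> B"
proof -
  obtain B where B: "0 < B" "\<And>z. z \<in> {0..a2} \<times> Cl \<Longrightarrow> norm (case z of (a,x) \<Rightarrow> \<phi> a x) \<le> B"
    using continuous_on_compact_bound[OF compact_dom assms] by blast
  have "norm (\<phi> a x) \<le> B" if "a \<in> {0..a2}" "x \<in> Cl" for a x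
    using B(2)[of "(a,x)"] that by simp
  then show ?thesis using that B(1) by blast
qed

lemma jc_measurable:
  fixes \<phi> :: "real \<Rightarrow> real^'n \<Rightarrow> complex"
  assumes "jc \<phi>" "x \<in> Cl" shows "(\<lambda>s. \<phi> s x) \<in> borel_measurable (MI a2)"
  by (rule continuous_on_measurable_MI[OF continuous_on_slice(2)[OF assms]])

lemma jc_kap: "jc (kap l)"
  unfolding kap_def
  by (intro jc_add jc_mult) (auto intro!: jc_snd jc_fst continuous_intros \<mu>2_cont RM_continuous)

lemma jc_exp_kap: "jc (\<lambda>a x. exp (kap l a x))" "jc (\<lambda>a x. exp (- kap l a x))"
  using jc_kap[of l] by (simp_all add: case_prod_beta continuous_on_exp continuous_on_minus)

lemma AC_kap: "AC a2 (\<lambda>a. kap l a x) (\<lambda>s. l + of_real (D + \<mu>2 x) + of_real (\<mu>1 s))"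
  unfolding kap_def by (rule AC_add[OF AC_linear AC_RM])

lemma kap_0: "kap l 0 x = 0"
  by (simp add: kap_def RM_0)

lemma jc_primitive:
  assumes "\<And>s. s \<in> {0<..<a2} \<Longrightarrow> continuous_on Cl (H s)"
    and "\<And>x. x \<in> Cl \<Longrightarrow> (\<lambda>s. H s x) \<in> borel_measurable (MI a2)"
    and "integrable (MI a2) B" and "AE s in MI a2. \<forall>x\<in>Cl. norm (H s x) \<le> B s"
  shows "jc (\<lambda>a x. primitive a2 (\<lambda>s. H s x) a)" "jc (\<lambda>a x. primitive a2 (\<lambda>s. H s x) a2)"
proof -
  have c: "continuous_on (UNIV \<times> Cl) (\<lambda>(a,x). primitive a2 (\<lambda>s. H s x) a)"
    by (rule continuous_on_parametric_primitive[OF assms])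
  show "jc (\<lambda>a x. primitive a2 (\<lambda>s. H s x) a)" by (rule continuous_on_subset[OF c]) auto
  show "jc (\<lambda>a x. primitive a2 (\<lambda>s. H s x) a2)"
    by (rule jc_snd) (rule continuous_on_slice(1)[OF c UNIV_I])
qed

lemma jc_Kop: "jc \<phi> \<Longrightarrow> jc (\<lambda>a x. Kop J \<Omega> (\<phi> a) x)"
  by (rule Kop_continuous[OF compact_Icc])

lemma jc_KD: "jc \<phi> \<Longrightarrow> jc (\<lambda>a x. exp (kap l a x) * (of_real D * Kop J \<Omega> (\<phi> a) x))"
  by (intro jc_mult jc_exp_kap jc_Kop jc_fst continuous_on_const)

lemma jc_integrable:
  assumes "jc \<phi>" "x \<in> Cl" shows "integrable (MI a2) (\<lambda>s. \<phi> s x :: complex)"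
proof -
  obtain B where "0 < B" and B: "\<And>a x. a \<in> {0..a2} \<Longrightarrow> x \<in> Cl \<Longrightarrow> norm (\<phi> a x) \<le> B"
    using jc_bound[OF assms(1)] by metis
  have "AE s in MI a2. norm (\<phi> s x) \<le> B" by (rule AE_I2, rule B[OF _ assms(2)]) simp
  then show ?thesis
    by (rule finite_measure.integrable_const_bound[OF finite_measure_MI _ jc_measurable[OF assms]])
qed

lemma \<beta>\<phi>_integrable:
  assumes "jc \<phi>" "x \<in> Cl" shows "integrable (MI a2) (\<lambda>s. complex_of_real (\<beta> s) * \<phi> s x)"
  by (intro integrable_mult_continuous_MI continuous_on_slice(2)[OF assms]) (simp add: \<beta>_integrable)

lemma jc_Sop:
  assumes "jc \<phi>" shows "jc (Sop l \<phi>)"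
proof -
  obtain B where B: "0 < B" "\<And>a x. a \<in> {0..a2} \<Longrightarrow> x \<in> Cl \<Longrightarrow> norm (\<phi> a x) \<le> B"
    using jc_bound[OF assms] by metis
  obtain B' where B': "0 < B'" "\<And>a x. a \<in> {0..a2} \<Longrightarrow> x \<in> Cl \<Longrightarrow>
      norm (exp (kap l a x) * (of_real D * Kop J \<Omega> (\<phi> a) x)) \<le> B'"
    using jc_bound[OF jc_KD[OF assms, of l]] by metis
  have 1: "jc (\<lambda>a x. primitive a2 (\<lambda>s. of_real (\<beta> s) * \<phi> s x) a2)"
  proof (rule jc_primitive(2)[where B="\<lambda>s. norm (\<beta> s) * B"])
    show "continuous_on Cl (\<lambda>x. of_real (\<beta> s) * \<phi> s x)" if "s \<in> {0<..<a2}" for s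
      using that by (intro continuous_intros continuous_on_slice(1)[OF assms]) auto
    show "(\<lambda>s. of_real (\<beta> s) * \<phi> s x) \<in> borel_measurable (MI a2)" if "x \<in> Cl" for x
      using \<beta>\<phi>_integrable[OF assms that] by simp
    show "integrable (MI a2) (\<lambda>s. norm (\<beta> s) * B)" using \<beta>_integrable by simp
    show "AE s in MI a2. \<forall>x\<in>Cl. norm (complex_of_real (\<beta> s) * \<phi> s x) \<le> norm (\<beta> s) * B"
      unfolding norm_mult norm_of_real real_norm_def
      by (intro AE_I2 ballI mult_left_mono B(2)) simp_all
  qed
  have 2: "jc (\<lambda>a x. primitive a2 (\<lambda>s. exp (kap l s x) * (of_real D * Kop J \<Omega> (\<phi> s) x)) a)"
  proof (rule jc_primitive(1)[where B="\<lambda>s. B'"])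
    show "continuous_on Cl (\<lambda>x. exp (kap l s x) * (of_real D * Kop J \<Omega> (\<phi> s) x))" if "s \<in> {0<..<a2}" for s
      using that by (intro continuous_on_slice(1)[OF jc_KD[OF assms]]) auto
    show "(\<lambda>s. exp (kap l s x) * (of_real D * Kop J \<Omega> (\<phi> s) x)) \<in> borel_measurable (MI a2)" if "x \<in> Cl" for x
      by (rule jc_measurable[OF jc_KD[OF assms] that])
    show "integrable (MI a2) (\<lambda>s. B')" by (rule finite_measure.integrable_const[OF finite_measure_MI])
    show "AE s in MI a2. \<forall>x\<in>Cl. norm (exp (kap l s x) * (of_real D * Kop J \<Omega> (\<phi> s) x)) \<le> B'"
      by (intro AE_I2 ballI B'(2)) simp_all
  qed
  show ?thesis unfolding Sop_def by (intro jc_mult jc_add jc_exp_kap 1 2)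
qed

lemma exp_kap_bound:
  obtains E where "1 \<le> E" "\<And>a x. a \<in> {0..a2} \<Longrightarrow> x \<in> Cl \<Longrightarrow> norm (exp (kap l a x)) \<le> E"
    "\<And>a x. a \<in> {0..a2} \<Longrightarrow> x \<in> Cl \<Longrightarrow> norm (exp (- kap l a x)) \<le> E"
proof -
  obtain B where "0 < B" and B: "\<And>a x. a \<in> {0..a2} \<Longrightarrow> x \<in> Cl \<Longrightarrow> norm (exp (kap l a x)) \<le> B"
    using jc_bound[OF jc_exp_kap(1)] by metis
  obtain B' where "0 < B'" and B': "\<And>a x. a \<in> {0..a2} \<Longrightarrow> x \<in> Cl \<Longrightarrow> norm (exp (- kap l a x)) \<le> B'"
    using jc_bound[OF jc_exp_kap(2)] by metis
  show ?thesis
    by (rule that[of "max 1 (max B B')"])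
       (simp, rule order_trans[OF B], assumption+, simp, rule order_trans[OF B'], assumption+, simp)
qed

lemma exp_kap_mult_integrable:
  assumes "g \<in> L1sp \<Omega> a2" "x \<in> Cl"
  shows "integrable (MI a2) (\<lambda>s. exp (kap l s x) * g s x)"
  using integrable_mult_continuous_MI[OF continuous_on_slice(2)[OF jc_exp_kap(1) assms(2)] L1spD(4)[OF assms]]
  by (simp add: mult.commute)

lemma jc_Rop:
  assumes f: "continuous_on Cl f" and g: "g \<in> L1sp \<Omega> a2" shows "jc (Rop l f g)"
proof -
  obtain E where E: "1 \<le> E" "\<And>a x. a \<in> {0..a2} \<Longrightarrow> x \<in> Cl \<Longrightarrow> norm (exp (kap l a x)) \<le> E"
    using exp_kap_bound by metis
  have "jc (\<lambda>a x. primitive a2 (\<lambda>s. exp (kap l s x) * g s x) a)"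
  proof (rule jc_primitive(1)[where B="\<lambda>s. E * supOm \<Omega> (g s)"])
    show "continuous_on Cl (\<lambda>x. exp (kap l s x) * g s x)" if "s \<in> {0<..<a2}" for s
      using that by (intro continuous_on_mult continuous_on_slice(1)[OF jc_exp_kap(1)] L1spD(1)[OF g]) auto
    show "(\<lambda>s. exp (kap l s x) * g s x) \<in> borel_measurable (MI a2)" if "x \<in> Cl" for x
      using exp_kap_mult_integrable[OF g that] by simp
    show "integrable (MI a2) (\<lambda>s. E * supOm \<Omega> (g s))" using L1spD(3)[OF g] by simp
    show "AE s in MI a2. \<forall>x\<in>Cl. norm (exp (kap l s x) * g s x) \<le> E * supOm \<Omega> (g s)"
      unfolding norm_mult using E
      by (intro AE_I2 ballI mult_mono norm_le_supOm L1spD(1)[OF g]) auto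
  qed
  then show ?thesis unfolding Rop_def by (intro jc_mult jc_add jc_exp_kap jc_snd f)
qed

lemma Rop_bound:
  obtains C where "0 < C" "\<And>f g a x. continuous_on Cl f \<Longrightarrow> g \<in> L1sp \<Omega> a2 \<Longrightarrow> a \<in> {0..a2} \<Longrightarrow> x \<in> Cl \<Longrightarrow>
     norm (Rop l f g a x) \<le> C * (supOm \<Omega> f + (LINT s|MI a2. supOm \<Omega> (g s)))"
proof -
  obtain E where E: "1 \<le> E" "\<And>a x. a \<in> {0..a2} \<Longrightarrow> x \<in> Cl \<Longrightarrow> norm (exp (kap l a x)) \<le> E"
    "\<And>a x. a \<in> {0..a2} \<Longrightarrow> x \<in> Cl \<Longrightarrow> norm (exp (- kap l a x)) \<le> E"
    using exp_kap_bound by metis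
  have "norm (Rop l f g a x) \<le> (E * E) * (supOm \<Omega> f + (LINT s|MI a2. supOm \<Omega> (g s)))"
    if f: "continuous_on Cl f" and g: "g \<in> L1sp \<Omega> a2" and a: "a \<in> {0..a2}" and x: "x \<in> Cl" for f g a x
  proof -
    have gn: "0 \<le> (if s \<le> a then E * supOm \<Omega> (g s) else 0)" "(if s \<le> a then E * supOm \<Omega> (g s) else 0) \<le> E * supOm \<Omega> (g s)"
      if "s \<in> {0<..<a2}" for s
      using supOm_nonneg[OF L1spD(1)[OF g that]] E by auto
    have gi: "integrable (MI a2) (\<lambda>s. E * supOm \<Omega> (g s))" using L1spD(3)[OF g] by simp
    have "norm (primitive a2 (\<lambda>s. exp (kap l s x) * g s x) a) \<le> (LINT s|MI a2. (if s \<le> a then E * supOm \<Omega> (g s) else 0))"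
    proof (rule norm_primitive_le[OF exp_kap_mult_integrable[OF g x] gi])
      show "AE s in MI a2. norm (exp (kap l s x) * g s x) \<le> E * supOm \<Omega> (g s)"
        unfolding norm_mult using E x
        by (intro AE_I2 mult_mono norm_le_supOm L1spD(1)[OF g]) auto
    qed
    also have "\<dots> \<le> (LINT s|MI a2. E * supOm \<Omega> (g s))"
    proof (rule integral_mono_AE[OF _ gi])
      have [measurable]: "(\<lambda>s. supOm \<Omega> (g s)) \<in> borel_measurable (MI a2)" using L1spD(3)[OF g] by simp
      show "integrable (MI a2) (\<lambda>s. if s \<le> a then E * supOm \<Omega> (g s) else 0)"
        by (rule Bochner_Integration.integrable_bound[OF gi]) auto
    qed (intro AE_I2 gn(2), simp)
    also have "\<dots> = E * (LINT s|MI a2. supOm \<Omega> (g s))" by simp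
    finally have p: "norm (primitive a2 (\<lambda>s. exp (kap l s x) * g s x) a) \<le> E * (LINT s|MI a2. supOm \<Omega> (g s))" .
    have "norm (f x) \<le> 1 * supOm \<Omega> f" using norm_le_supOm[OF f x] by simp
    also have "\<dots> \<le> E * supOm \<Omega> f" using E supOm_nonneg[OF f] by (intro mult_right_mono) auto
    finally have fb: "norm (f x) \<le> E * supOm \<Omega> f" .
    have "norm (Rop l f g a x) \<le> E * (E * supOm \<Omega> f + E * (LINT s|MI a2. supOm \<Omega> (g s)))"
      unfolding Rop_def norm_mult
      using E(1) E(3)[OF a x] norm_triangle_mono[OF fb p] by (intro mult_mono) auto
    then show ?thesis by (simp add: algebra_simps)
  qed
  then show ?thesis using E(1) by (intro that[of "E * E"]) auto
qed

lemma Sop_diff: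
  assumes "jc \<phi>" "jc \<eta>" "x \<in> Cl"
  shows "Sop l (\<lambda>a x. \<phi> a x - \<eta> a x) a x = Sop l \<phi> a x - Sop l \<eta> a x"
proof -
  have pd: "primitive a2 (\<lambda>s. p s - q s) a = primitive a2 p a - primitive a2 q a"
    if "integrable (MI a2) p" "integrable (MI a2) q" for p q a
    using primitive_add[of a2 p "\<lambda>s. - 1 * q s" a] primitive_cmult[of a2 "- 1" q a] that by simp
  have 1: "primitive a2 (\<lambda>s. of_real (\<beta> s) * (\<phi> s x - \<eta> s x)) a2
     = primitive a2 (\<lambda>s. of_real (\<beta> s) * \<phi> s x) a2 - primitive a2 (\<lambda>s. of_real (\<beta> s) * \<eta> s x) a2"
    unfolding right_diff_distrib by (intro pd \<beta>\<phi>_integrable assms)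
  have "primitive a2 (\<lambda>s. exp (kap l s x) * (of_real D * Kop J \<Omega> (\<lambda>x. \<phi> s x - \<eta> s x) x)) a
     = primitive a2 (\<lambda>s. exp (kap l s x) * (of_real D * Kop J \<Omega> (\<phi> s) x) - exp (kap l s x) * (of_real D * Kop J \<Omega> (\<eta> s) x)) a"
  proof (rule primitive_cong)
    fix s assume "s \<in> {0<..<a2}"
    then have "s \<in> {0..a2}" by auto
    then have "Kop J \<Omega> (\<lambda>x. \<phi> s x - \<eta> s x) x = Kop J \<Omega> (\<phi> s) x - Kop J \<Omega> (\<eta> s) x"
      by (intro Kop_diff continuous_on_slice(1)[OF assms(1)] continuous_on_slice(1)[OF assms(2)])
    then show "exp (kap l s x) * (of_real D * Kop J \<Omega> (\<lambda>x. \<phi> s x - \<eta> s x) x)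
      = exp (kap l s x) * (of_real D * Kop J \<Omega> (\<phi> s) x) - exp (kap l s x) * (of_real D * Kop J \<Omega> (\<eta> s) x)"
      by (simp only: right_diff_distrib)
  qed
  also have "\<dots> = primitive a2 (\<lambda>s. exp (kap l s x) * (of_real D * Kop J \<Omega> (\<phi> s) x)) a
     - primitive a2 (\<lambda>s. exp (kap l s x) * (of_real D * Kop J \<Omega> (\<eta> s) x)) a"
    by (intro pd jc_integrable jc_KD assms)
  finally have 2: "primitive a2 (\<lambda>s. exp (kap l s x) * (of_real D * Kop J \<Omega> (\<lambda>x. \<phi> s x - \<eta> s x) x)) a = \<dots>" .
  show ?thesis unfolding Sop_def 1 2 by (simp only: right_diff_distrib distrib_left) simp
qed

definition \<Phi> :: "real \<Rightarrow> real \<Rightarrow> real^'n \<Rightarrow> real" where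
  "\<Phi> t a x = exp (- t * a - RM a) * v x"

lemma \<Phi>_cont: "jc (\<Phi> t)"
proof -
  have "jc (\<lambda>a x. exp (- t * a - RM a))" by (intro jc_fst continuous_intros RM_continuous)
  moreover have "jc (\<lambda>a. v)" by (rule jc_snd[OF v_cont])
  ultimately show ?thesis unfolding \<Phi>_def case_prod_beta by (rule continuous_on_mult)
qed

lemma \<Phi>_pos: "x \<in> Cl \<Longrightarrow> 0 < \<Phi> t a x"
  by (simp add: \<Phi>_def v_pos)

lemma eigen_coefficient_nonneg:
  assumes "x \<in> Cl" shows "0 \<le> lp + D + \<mu>2 x"
proof -
  have "0 \<le> Kr v x" unfolding Kr_def
    by (rule integral_nonneg_AE) (intro AE_I2 mult_nonneg_nonneg J_nonneg less_imp_le[OF v_pos], simp add: dom_in_Cl)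
  then have "0 \<le> (lp + D + \<mu>2 x) * v x" using v_eigen[OF assms] D_pos by (metis mult_nonneg_nonneg less_imp_le)
  then show ?thesis using v_pos[OF assms] by (simp add: zero_le_mult_iff)
qed

text \<open>For \<open>\<phi> = \<Phi> t\<close> and real \<open>l\<close> the operator can be evaluated exactly: with \<open>q = lp + D + \<mu>2 x\<close> and
  \<open>m = q + l - lp - t\<close>, \<open>Sop l \<phi>\<close> is \<open>\<Phi> t\<close> times the convex combination of \<open>F t\<close> and \<open>q / m\<close> with weight
  \<open>exp (- m a)\<close>. Both numbers are below \<open>1\<close>.\<close>

lemma Sop_contraction:
  assumes t: "F t < 1" and tl: "t + lp < Re l"
  obtains \<theta> where "0 \<le> \<theta>" "\<theta> < 1"
    "\<And>\<phi> c a x. jc \<phi> \<Longrightarrow> 0 \<le> c \<Longrightarrow>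
      (\<And>a x. a \<in> {0..a2} \<Longrightarrow> x \<in> Cl \<Longrightarrow> norm (\<phi> a x) \<le> c * \<Phi> t a x) \<Longrightarrow>
      a \<in> {0..a2} \<Longrightarrow> x \<in> Cl \<Longrightarrow> norm (Sop l \<phi> a x) \<le> \<theta> * c * \<Phi> t a x"
proof -
  define \<delta> where "\<delta> = Re l - lp - t"
  have \<delta>: "0 < \<delta>" using tl by (simp add: \<delta>_def)
  have "continuous_on Cl (\<lambda>x. lp + D + \<mu>2 x)" by (intro continuous_intros \<mu>2_cont)
  from continuous_on_compact_bound[OF compact_Cl this] obtain Q where
    Q: "0 < Q" "\<And>x. x \<in> Cl \<Longrightarrow> norm (lp + D + \<mu>2 x) \<le> Q" by blast
  define \<theta> where "\<theta> = max (F t) (Q / (Q + \<delta>))"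
  have \<theta>: "0 \<le> \<theta>" "\<theta> < 1" using t Q \<delta> by (auto simp: \<theta>_def le_max_iff_disj)
  have "norm (Sop l \<phi> a x) \<le> \<theta> * c * \<Phi> t a x"
    if \<phi>: "jc \<phi>" and c: "0 \<le> c" and le: "\<And>a x. a \<in> {0..a2} \<Longrightarrow> x \<in> Cl \<Longrightarrow> norm (\<phi> a x) \<le> c * \<Phi> t a x"
      and a: "a \<in> {0..a2}" and x: "x \<in> Cl" for \<phi> c a x
  proof -
    define q where "q = lp + D + \<mu>2 x"
    define m where "m = q + \<delta>"
    have q: "0 \<le> q" "q \<le> Q" using eigen_coefficient_nonneg[OF x] Q(2)[OF x] by (auto simp: q_def)
    have m: "0 < m" using q \<delta> by (simp add: m_def)
    have vx: "0 < v x" by (rule v_pos[OF x])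
    have Rekap: "Re (kap l s x) = (m + t) * s + RM s" for s
      by (simp add: kap_def m_def \<delta>_def q_def algebra_simps)
    have "norm (primitive a2 (\<lambda>s. complex_of_real (\<beta> s) * \<phi> s x) a2)
       \<le> (LINT s|MI a2. (if s \<le> a2 then (c * v x) * (\<beta> s * exp (- t * s - RM s)) else 0))"
    proof (rule norm_primitive_le[OF \<beta>\<phi>_integrable[OF \<phi> x]])
      show "integrable (MI a2) (\<lambda>s. (c * v x) * (\<beta> s * exp (- t * s - RM s)))"
        using F_integrable by (rule integrable_mult_right)
      show "AE s in MI a2. norm (complex_of_real (\<beta> s) * \<phi> s x) \<le> (c * v x) * (\<beta> s * exp (- t * s - RM s))"
        using \<beta>_bounds AE_space
      proof eventually_elim
        case (elim s)
        have "norm (\<phi> s x) \<le> c * \<Phi> t s x" by (rule le) (use elim x in auto)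
        then have "\<beta> s * norm (\<phi> s x) \<le> \<beta> s * (c * \<Phi> t s x)" using elim by (intro mult_left_mono) auto
        then show ?case using elim by (simp add: norm_mult \<Phi>_def mult_ac)
      qed
    qed
    also have "\<dots> = (LINT s|MI a2. (c * v x) * (\<beta> s * exp (- t * s - RM s)))"
      by (rule Bochner_Integration.integral_cong) auto
    also have "\<dots> = c * v x * F t" unfolding F_def by (rule integral_mult_right_zero)
    finally have 1: "norm (primitive a2 (\<lambda>s. complex_of_real (\<beta> s) * \<phi> s x) a2) \<le> c * v x * F t" .
    have "norm (primitive a2 (\<lambda>s. exp (kap l s x) * (of_real D * Kop J \<Omega> (\<phi> s) x)) a)
       \<le> (LINT s|MI a2. (if s \<le> a then (c * q * v x) * exp (m * s) else 0))"
    proof (rule norm_primitive_le[OF jc_integrable[OF jc_KD[OF \<phi>] x]])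
      show "integrable (MI a2) (\<lambda>s. (c * q * v x) * exp (m * s))"
        by (intro integrable_mult_continuous_MI continuous_intros finite_measure.integrable_const finite_measure_MI)
      show "AE s in MI a2. norm (exp (kap l s x) * (of_real D * Kop J \<Omega> (\<phi> s) x)) \<le> (c * q * v x) * exp (m * s)"
      proof (rule AE_I2)
        fix s assume "s \<in> space (MI a2)"
        then have s: "s \<in> {0..a2}" by auto
        have "norm (Kop J \<Omega> (\<phi> s) x) \<le> Kr (\<lambda>y. c * exp (- t * s - RM s) * v y) x"
          using le[OF s]
          by (intro norm_Kop_le continuous_on_slice(1)[OF \<phi> s] continuous_intros v_cont) (simp add: \<Phi>_def mult.assoc)
        also have "\<dots> = c * exp (- t * s - RM s) * Kr v x"
          unfolding Kr_def by (subst integral_mult_right_zero[symmetric]) (simp only: mult_ac)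
        finally have "D * norm (Kop J \<Omega> (\<phi> s) x) \<le> D * (c * exp (- t * s - RM s) * Kr v x)"
          using D_pos by (intro mult_left_mono) auto
        also have "\<dots> = c * exp (- t * s - RM s) * (q * v x)"
          using v_eigen[OF x] by (metis q_def mult.left_commute)
        finally have "exp ((m + t) * s + RM s) * (D * norm (Kop J \<Omega> (\<phi> s) x))
           \<le> exp ((m + t) * s + RM s) * (c * exp (- t * s - RM s) * (q * v x))"
          by (intro mult_left_mono) auto
        also have "\<dots> = (c * q * v x) * (exp ((m + t) * s + RM s) * exp (- t * s - RM s))"
          by (simp only: mult_ac)
        also have "exp ((m + t) * s + RM s) * exp (- t * s - RM s) = exp (m * s)"
          unfolding exp_add[symmetric] by (simp add: algebra_simps)
        finally show "norm (exp (kap l s x) * (of_real D * Kop J \<Omega> (\<phi> s) x)) \<le> (c * q * v x) * exp (m * s)"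
          using D_pos by (simp add: norm_mult Rekap)
      qed
    qed
    also have "\<dots> = (LINT s|MI a2. (c * q * v x) * (if s \<le> a then exp (m * s) else 0))"
      by (rule Bochner_Integration.integral_cong) auto
    also have "\<dots> = (c * q * v x) * ((exp (m * a) - 1) / m)"
      unfolding integral_mult_right_zero using m a by (subst integral_exp_linear) auto
    finally have 2: "norm (primitive a2 (\<lambda>s. exp (kap l s x) * (of_real D * Kop J \<Omega> (\<phi> s) x)) a)
       \<le> (c * q * v x) * ((exp (m * a) - 1) / m)" .
    define y where "y = exp (- m * a)"
    have y: "0 \<le> y" "y \<le> 1" using m a by (auto simp: y_def)
    have ea: "exp (- ((m + t) * a + RM a)) = y * exp (- t * a - RM a)"
      unfolding y_def exp_add[symmetric] by (simp add: algebra_simps)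
    have ym: "y * exp (m * a) = 1" unfolding y_def exp_add[symmetric] by simp
    have "norm (Sop l \<phi> a x) \<le> exp (- ((m + t) * a + RM a)) * (c * v x * F t + (c * q * v x) * ((exp (m * a) - 1) / m))"
      unfolding Sop_def norm_mult using norm_triangle_mono[OF 1 2]
      by (simp add: Rekap)
    also have "\<dots> = c * \<Phi> t a x * (F t * y + q / m * (y * exp (m * a) - y))"
      unfolding ea \<Phi>_def using m by (simp add: field_simps)
    also have "\<dots> \<le> c * \<Phi> t a x * \<theta>"
    proof (rule mult_left_mono)
      have "q / m \<le> Q / (Q + \<delta>)" using q Q \<delta> m by (simp add: m_def field_simps)
      then have "q / m \<le> \<theta>" "F t \<le> \<theta>" by (auto simp: \<theta>_def le_max_iff_disj)
      then have "F t * y + q / m * (1 - y) \<le> \<theta> * y + \<theta> * (1 - y)"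
        using y by (intro add_mono mult_right_mono) auto
      then show "F t * y + q / m * (y * exp (m * a) - y) \<le> \<theta>" unfolding ym by (simp add: algebra_simps)
      show "0 \<le> c * \<Phi> t a x" using c \<Phi>_pos[OF x, of t a] by simp
    qed
    finally show ?thesis by (simp add: mult_ac)
  qed
  then show ?thesis using that \<theta> by blast
qed

end

section \<open>The spectral bound\<close>

context age_model_eigen
begin

abbreviation solves :: "complex \<Rightarrow> (real \<Rightarrow> real^'n \<Rightarrow> complex) \<Rightarrow> (real \<Rightarrow> real^'n \<Rightarrow> complex)
    \<Rightarrow> (real^'n \<Rightarrow> complex) \<Rightarrow> (real \<Rightarrow> real^'n \<Rightarrow> complex) \<Rightarrow> bool" where
  "solves l \<phi> \<psi> f g \<equiv> W11 \<Omega> a2 \<phi> \<psi> \<and>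
     res_eq J \<Omega> D (\<lambda>a x. \<beta> a) (\<lambda>a x. \<mu>1 a + \<mu>2 x) a2 l \<phi> \<psi> f g"

lemma ode_rhs_split:
  assumes \<phi>: "jc \<phi>" and g: "g \<in> L1sp \<Omega> a2" and x: "x \<in> Cl"
  shows "integrable (MI a2) (\<lambda>s. of_real D * Kop J \<Omega> (\<phi> s) x + g s x)"
    and "primitive a2 (\<lambda>s. exp (kap l s x) * (of_real D * Kop J \<Omega> (\<phi> s) x + g s x)) a =
      primitive a2 (\<lambda>s. exp (kap l s x) * (of_real D * Kop J \<Omega> (\<phi> s) x)) a
      + primitive a2 (\<lambda>s. exp (kap l s x) * g s x) a"
proof -
  show "integrable (MI a2) (\<lambda>s. of_real D * Kop J \<Omega> (\<phi> s) x + g s x)"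
    by (intro Bochner_Integration.integrable_add integrable_mult_right jc_integrable jc_Kop \<phi> L1spD(4)[OF g] x)
  show "primitive a2 (\<lambda>s. exp (kap l s x) * (of_real D * Kop J \<Omega> (\<phi> s) x + g s x)) a =
      primitive a2 (\<lambda>s. exp (kap l s x) * (of_real D * Kop J \<Omega> (\<phi> s) x)) a
      + primitive a2 (\<lambda>s. exp (kap l s x) * g s x) a"
    unfolding distrib_left[of "exp _"]
    by (intro primitive_add jc_integrable jc_KD \<phi> x exp_kap_mult_integrable g)
qed

lemma Rop_add_Sop:
  "Rop l f g a x + Sop l \<phi> a x = exp (- kap l a x) * (f x + primitive a2 (\<lambda>s. of_real (\<beta> s) * \<phi> s x) a2
     + (primitive a2 (\<lambda>s. exp (kap l s x) * (of_real D * Kop J \<Omega> (\<phi> s) x)) a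
      + primitive a2 (\<lambda>s. exp (kap l s x) * g s x) a))"
  unfolding Rop_def Sop_def by (simp only: distrib_left[symmetric] add_ac)

lemma solves_imp_fixed_point:
  assumes sol: "solves l \<phi> \<psi> f g" and g: "g \<in> L1sp \<Omega> a2"
  shows "jc \<phi>" and "\<And>a x. a \<in> {0..a2} \<Longrightarrow> x \<in> Cl \<Longrightarrow> \<phi> a x = Rop l f g a x + Sop l \<phi> a x"
proof -
  have W: "W11 \<Omega> a2 \<phi> \<psi>" using sol by blast
  show \<phi>: "jc \<phi>" by (rule W11_continuous[OF W]) (use a2_pos in simp)
  fix a x assume a: "a \<in> {0..a2}" and x: "x \<in> Cl"
  have bc: "\<phi> 0 x = f x + primitive a2 (\<lambda>s. of_real (\<beta> s) * \<phi> s x) a2"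
    using sol x unfolding res_eq_def primitive_end by (simp add: diff_eq_eq)
  have "AE s in MI a2. \<forall>x\<in>Cl. l * \<phi> s x + \<psi> s x - complex_of_real D * (Kop J \<Omega> (\<phi> s) x - \<phi> s x)
        + complex_of_real (\<mu>1 s + \<mu>2 x) * \<phi> s x = g s x"
    using sol unfolding res_eq_def by blast
  then have ode: "AE s in MI a2. \<psi> s x = (of_real D * Kop J \<Omega> (\<phi> s) x + g s x) - (l + of_real (D + \<mu>2 x) + of_real (\<mu>1 s)) * \<phi> s x"
  proof eventually_elim
    case (elim s)
    from elim[rule_format, OF x, symmetric] show ?case by (simp add: algebra_simps)
  qed
  have "\<phi> a x = exp (- kap l a x) * (\<phi> 0 x + primitive a2 (\<lambda>s. exp (kap l s x) * (of_real D * Kop J \<Omega> (\<phi> s) x + g s x)) a)"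
    by (rule linear_ode_solution[OF W11_AC[OF W x] AC_kap kap_0 _ ode a])
       (rule borel_measurable_integrable[OF ode_rhs_split(1)[OF \<phi> g x]])
  then show "\<phi> a x = Rop l f g a x + Sop l \<phi> a x"
    unfolding bc ode_rhs_split(2)[OF \<phi> g x] Rop_add_Sop .
qed

lemma fixed_point_imp_solves:
  assumes \<phi>: "jc \<phi>" and g: "g \<in> L1sp \<Omega> a2"
    and eq: "\<And>a x. a \<in> {0..a2} \<Longrightarrow> x \<in> Cl \<Longrightarrow> \<phi> a x = Rop l f g a x + Sop l \<phi> a x"
  shows "\<exists>\<psi>. solves l \<phi> \<psi> f g"
proof -
  define h where "h s x = of_real D * Kop J \<Omega> (\<phi> s) x - (l + of_real (D + \<mu>2 x)) * \<phi> s x" for s x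
  define \<psi> where "\<psi> s x = h s x + g s x - of_real (\<mu>1 s) * \<phi> s x" for s x
  have \<psi>_eq: "\<psi> s x = (of_real D * Kop J \<Omega> (\<phi> s) x + g s x) - (l + of_real (D + \<mu>2 x) + of_real (\<mu>1 s)) * \<phi> s x" for s x
    by (simp add: \<psi>_def h_def algebra_simps)
  have "continuous_on Cl (\<lambda>x. l + of_real (D + \<mu>2 x))" by (intro continuous_intros \<mu>2_cont)
  from jc_diff[OF jc_mult[OF jc_fst[OF continuous_on_const] jc_Kop[OF \<phi>]] jc_mult[OF jc_snd[OF this] \<phi>]]
  have h: "jc h" unfolding h_def .
  define c where "c x = f x + primitive a2 (\<lambda>s. of_real (\<beta> s) * \<phi> s x) a2" for x
  have formula: "\<phi> a x = exp (- kap l a x) * (c x + primitive a2 (\<lambda>s. exp (kap l s x) * (of_real D * Kop J \<Omega> (\<phi> s) x + g s x)) a)"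
    if a: "a \<in> {0..a2}" and x: "x \<in> Cl" for a x
    unfolding ode_rhs_split(2)[OF \<phi> g x] c_def using eq[OF a x] unfolding Rop_add_Sop .
  have AC: "AC a2 (\<lambda>a. \<phi> a x) (\<lambda>s. \<psi> s x)" if x: "x \<in> Cl" for x
    unfolding \<psi>_eq
    by (rule linear_ode_solves[where \<kappa>="\<lambda>a. kap l a x" and c="c x", OF AC_kap ode_rhs_split(1)[OF \<phi> g x]])
       (use a2_pos in simp, erule formula[OF _ x])
  obtain Bh where "0 < Bh" and Bh: "\<And>a x. a \<in> {0..a2} \<Longrightarrow> x \<in> Cl \<Longrightarrow> norm (h a x) \<le> Bh"
    using jc_bound[OF h] by metis
  obtain B where B: "0 < B" "\<And>a x. a \<in> {0..a2} \<Longrightarrow> x \<in> Cl \<Longrightarrow> norm (\<phi> a x) \<le> B"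
    using jc_bound[OF \<phi>] by metis
  have L: "\<psi> \<in> L1sp \<Omega> a2"
  proof (rule L1spI[where B="\<lambda>s. Bh + supOm \<Omega> (g s) + norm (\<mu>1 s) * B"])
    show "continuous_on Cl (\<psi> s)" if "s \<in> {0<..<a2}" for s
    proof -
      have s: "s \<in> {0..a2}" using that by auto
      show ?thesis
        unfolding \<psi>_def
        by (rule continuous_on_diff[OF continuous_on_add[OF continuous_on_slice(1)[OF h s] L1spD(1)[OF g that]]
            continuous_on_mult[OF continuous_on_const continuous_on_slice(1)[OF \<phi> s]]])
    qed
    show "(\<lambda>s. \<psi> s x) \<in> borel_measurable (MI a2)" if "x \<in> Cl" for x
      by (rule borel_measurable_integrable[OF AC_integrable[OF AC[OF that]]])
    show "integrable (MI a2) (\<lambda>s. Bh + supOm \<Omega> (g s) + norm (\<mu>1 s) * B)"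
      by (intro Bochner_Integration.integrable_add finite_measure.integrable_const[OF finite_measure_MI]
          L1spD(3)[OF g] integrable_mult_left integrable_norm[OF \<mu>1_integrable])
    show "AE s in MI a2. \<forall>x\<in>Cl. norm (\<psi> s x) \<le> Bh + supOm \<Omega> (g s) + norm (\<mu>1 s) * B"
    proof (intro AE_I2 ballI)
      fix s x assume "s \<in> space (MI a2)" and x: "x \<in> Cl"
      then have s: "s \<in> {0<..<a2}" "s \<in> {0..a2}" by auto
      have "norm (of_real (\<mu>1 s) * \<phi> s x) \<le> norm (\<mu>1 s) * B"
        unfolding norm_mult norm_of_real real_norm_def by (rule mult_left_mono[OF B(2)[OF s(2) x]]) simp
      moreover have "norm (h s x + g s x) \<le> Bh + supOm \<Omega> (g s)"
        by (rule norm_triangle_mono[OF Bh[OF s(2) x] norm_le_supOm[OF L1spD(1)[OF g s(1)] x]])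
      ultimately show "norm (\<psi> s x) \<le> Bh + supOm \<Omega> (g s) + norm (\<mu>1 s) * B"
        unfolding \<psi>_def by (intro order_trans[OF norm_triangle_ineq4] add_mono)
    qed
  qed
  have W: "W11 \<Omega> a2 \<phi> \<psi>" by (rule W11_I[OF L continuous_on_slice(1)[OF \<phi>] AC])
  have "res_eq J \<Omega> D (\<lambda>a x. \<beta> a) (\<lambda>a x. \<mu>1 a + \<mu>2 x) a2 l \<phi> \<psi> f g"
    unfolding res_eq_def
  proof (intro conjI ballI AE_I2)
    fix x assume x: "x \<in> Cl"
    have "\<phi> 0 x = c x" by (subst formula[OF _ x]) (use a2_pos in \<open>simp_all add: kap_0 primitive_0\<close>)
    then show "\<phi> 0 x - (LINT a|MI a2. of_real (\<beta> a) * \<phi> a x) = f x"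
      by (simp only: c_def primitive_end add_diff_cancel_right')
  next
    fix a x
    show "l * \<phi> a x + \<psi> a x - of_real D * (Kop J \<Omega> (\<phi> a) x - \<phi> a x) + of_real (\<mu>1 a + \<mu>2 x) * \<phi> a x = g a x"
      unfolding \<psi>_eq of_real_add by (simp add: algebra_simps)
  qed
  then show ?thesis using W by blast
qed

lemma fixed_point_bound:
  assumes t: "F t < 1" and tl: "t + lp < Re l"
  obtains C where "0 < C" "\<And>f g \<phi> a x. continuous_on Cl f \<Longrightarrow> g \<in> L1sp \<Omega> a2 \<Longrightarrow> jc \<phi> \<Longrightarrow>
      (\<And>a x. a \<in> {0..a2} \<Longrightarrow> x \<in> Cl \<Longrightarrow> \<phi> a x = Rop l f g a x + Sop l \<phi> a x) \<Longrightarrow>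
      a \<in> {0..a2} \<Longrightarrow> x \<in> Cl \<Longrightarrow>
      norm (\<phi> a x) \<le> C * (supOm \<Omega> f + (LINT s|MI a2. supOm \<Omega> (g s)))"
proof -
  obtain \<theta> where \<theta>: "0 \<le> \<theta>" "\<theta> < 1" and contr: "\<And>\<phi> c a x. jc \<phi> \<Longrightarrow> 0 \<le> c \<Longrightarrow>
      (\<And>a x. a \<in> {0..a2} \<Longrightarrow> x \<in> Cl \<Longrightarrow> norm (\<phi> a x) \<le> c * \<Phi> t a x) \<Longrightarrow>
      a \<in> {0..a2} \<Longrightarrow> x \<in> Cl \<Longrightarrow> norm (Sop l \<phi> a x) \<le> \<theta> * c * \<Phi> t a x"
    using Sop_contraction[OF t tl] by metis
  obtain CR where CR: "0 < CR" "\<And>f g a x. continuous_on Cl f \<Longrightarrow> g \<in> L1sp \<Omega> a2 \<Longrightarrow> a \<in> {0..a2} \<Longrightarrow> x \<in> Cl \<Longrightarrow>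
     norm (Rop l f g a x) \<le> CR * (supOm \<Omega> f + (LINT s|MI a2. supOm \<Omega> (g s)))"
    using Rop_bound by metis
  have "{0..a2} \<times> Cl \<noteq> {}" using a2_pos nonempty_dom by auto
  from continuous_attains_inf[OF compact_dom this \<Phi>_cont[of t]] obtain z0 where
    z0: "z0 \<in> {0..a2} \<times> Cl" "\<And>z. z \<in> {0..a2} \<times> Cl \<Longrightarrow> (case z0 of (a,x) \<Rightarrow> \<Phi> t a x) \<le> (case z of (a,x) \<Rightarrow> \<Phi> t a x)"
    by blast
  define m where "m = (case z0 of (a,x) \<Rightarrow> \<Phi> t a x)"
  have m: "0 < m" using z0(1) \<Phi>_pos by (auto simp: m_def)
  have m_le: "m \<le> \<Phi> t a x" if "a \<in> {0..a2}" "x \<in> Cl" for a x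
    using z0(2)[of "(a,x)"] that by (simp add: m_def)
  obtain M where M: "0 < M" "\<And>a x. a \<in> {0..a2} \<Longrightarrow> x \<in> Cl \<Longrightarrow> norm (\<Phi> t a x) \<le> M"
    using jc_bound[OF \<Phi>_cont] by metis
  have "norm (\<phi> a x) \<le> (CR / m / (1 - \<theta>) * M) * N"
    if f: "continuous_on Cl f" and g: "g \<in> L1sp \<Omega> a2" and \<phi>: "jc \<phi>"
      and eq: "\<And>a x. a \<in> {0..a2} \<Longrightarrow> x \<in> Cl \<Longrightarrow> \<phi> a x = Rop l f g a x + Sop l \<phi> a x"
      and a: "a \<in> {0..a2}" and x: "x \<in> Cl" and N: "N = supOm \<Omega> f + (LINT s|MI a2. supOm \<Omega> (g s))" for f g \<phi> a x N
  proof -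
    have N0: "0 \<le> N" unfolding N
      by (intro add_nonneg_nonneg supOm_nonneg f integral_nonneg_AE AE_I2 L1spD(1)[OF g]) simp
    define r where "r = CR * N / m"
    have r: "0 \<le> r" using CR(1) N0 m by (simp add: r_def)
    have R: "norm (Rop l f g a x) \<le> r * \<Phi> t a x" if "a \<in> {0..a2}" "x \<in> Cl" for a x
    proof -
      have "norm (Rop l f g a x) \<le> r * m" using CR(2)[OF f g that] m by (simp add: r_def N)
      also have "\<dots> \<le> r * \<Phi> t a x" using m_le[OF that] r by (rule mult_left_mono)
      finally show ?thesis .
    qed
    have "norm (case (a,x) of (a,x) \<Rightarrow> \<phi> a x) \<le> r / (1 - \<theta>) * (case (a,x) of (a,x) \<Rightarrow> \<Phi> t a x)"
    proof (rule weighted_contraction_bound[OF compact_dom \<Phi>_cont _ \<phi> \<theta>(2)])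
      show "0 < (case z of (a,x) \<Rightarrow> \<Phi> t a x)" if "z \<in> {0..a2} \<times> Cl" for z
        using that \<Phi>_pos by auto
      show "(a,x) \<in> {0..a2} \<times> Cl" using a x by simp
      fix c z assume c: "0 \<le> c" and z: "z \<in> {0..a2} \<times> Cl"
        and le: "\<And>z. z \<in> {0..a2} \<times> Cl \<Longrightarrow> norm (case z of (a,x) \<Rightarrow> \<phi> a x) \<le> c * (case z of (a,x) \<Rightarrow> \<Phi> t a x)"
      obtain b y where zy: "z = (b,y)" "b \<in> {0..a2}" "y \<in> Cl" using z by blast
      have "norm (\<phi> a x) \<le> c * \<Phi> t a x" if "a \<in> {0..a2}" "x \<in> Cl" for a x
        using le[of "(a,x)"] that by simp
      from contr[OF \<phi> c this zy(2,3)] have "norm (Sop l \<phi> b y) \<le> \<theta> * c * \<Phi> t b y" by simp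
      from norm_triangle_mono[OF R[OF zy(2,3)] this]
      show "norm (case z of (a,x) \<Rightarrow> \<phi> a x) \<le> (r + \<theta> * c) * (case z of (a,x) \<Rightarrow> \<Phi> t a x)"
        unfolding zy(1) prod.case eq[OF zy(2,3)] distrib_right .
    qed
    then have "norm (\<phi> a x) \<le> r / (1 - \<theta>) * \<Phi> t a x" by simp
    also have "\<dots> \<le> r / (1 - \<theta>) * M" using M(2)[OF a x] r \<theta> by (intro mult_left_mono) auto
    finally show ?thesis by (simp add: r_def mult_ac)
  qed
  then show ?thesis using CR(1) m \<theta> M(1) by (intro that[of "CR / m / (1 - \<theta>) * M"]) auto
qed

lemma fixed_point_exists:
  assumes t: "F t < 1" and tl: "t + lp < Re l" and f: "continuous_on Cl f" and g: "g \<in> L1sp \<Omega> a2"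
  obtains \<phi> where "jc \<phi>" "\<And>a x. a \<in> {0..a2} \<Longrightarrow> x \<in> Cl \<Longrightarrow> \<phi> a x = Rop l f g a x + Sop l \<phi> a x"
proof -
  obtain \<theta> where \<theta>: "0 \<le> \<theta>" "\<theta> < 1" and contr: "\<And>\<phi> c a x. jc \<phi> \<Longrightarrow> 0 \<le> c \<Longrightarrow>
      (\<And>a x. a \<in> {0..a2} \<Longrightarrow> x \<in> Cl \<Longrightarrow> norm (\<phi> a x) \<le> c * \<Phi> t a x) \<Longrightarrow>
      a \<in> {0..a2} \<Longrightarrow> x \<in> Cl \<Longrightarrow> norm (Sop l \<phi> a x) \<le> \<theta> * c * \<Phi> t a x"
    using Sop_contraction[OF t tl] by metis
  define T where "T u = (\<lambda>(a,x). Rop l f g a x + Sop l (\<lambda>a x. u (a,x)) a x)" for u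
  have jc_curry: "jc (\<lambda>a x. u (a,x))" if "continuous_on ({0..a2} \<times> Cl) u" for u :: "real \<times> (real^'n) \<Rightarrow> complex"
    using that by (simp add: case_prod_beta)
  have "\<exists>u. continuous_on ({0..a2} \<times> Cl) u \<and> (\<forall>z\<in>{0..a2} \<times> Cl. u z = T u z)"
  proof (rule weighted_contraction_fixed_point[OF compact_dom \<Phi>_cont _ _ \<theta>, of t T])
    show "0 < (case z of (a,x) \<Rightarrow> \<Phi> t a x)" if "z \<in> {0..a2} \<times> Cl" for z
      using that \<Phi>_pos by auto
    show "continuous_on ({0..a2} \<times> Cl) (T u)" if "continuous_on ({0..a2} \<times> Cl) u" for u
      unfolding T_def by (intro jc_add jc_Rop jc_Sop jc_curry that f g)
    fix u w :: "real \<times> (real^'n) \<Rightarrow> complex" and c z assume u: "continuous_on ({0..a2} \<times> Cl) u" and w: "continuous_on ({0..a2} \<times> Cl) w"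
      and c: "0 \<le> (c::real)" and z: "z \<in> {0..a2} \<times> Cl"
      and le: "\<And>z. z \<in> {0..a2} \<times> Cl \<Longrightarrow> norm (u z - w z) \<le> c * (case z of (a,x) \<Rightarrow> \<Phi> t a x)"
    obtain b y where zy: "z = (b,y)" "b \<in> {0..a2}" "y \<in> Cl" using z by blast
    have "norm (u (a,x) - w (a,x)) \<le> c * \<Phi> t a x" if "a \<in> {0..a2}" "x \<in> Cl" for a x
      using le[of "(a,x)"] that by simp
    from contr[OF jc_diff[OF jc_curry[OF u] jc_curry[OF w]] c this zy(2,3)]
    have "norm (Sop l (\<lambda>a x. u (a,x) - w (a,x)) b y) \<le> \<theta> * c * \<Phi> t b y" by simp
    then show "norm (T u z - T w z) \<le> \<theta> * c * (case z of (a,x) \<Rightarrow> \<Phi> t a x)"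
      unfolding Sop_diff[OF jc_curry[OF u] jc_curry[OF w] zy(3)] by (simp add: T_def zy(1))
  qed
  then obtain u where u: "continuous_on ({0..a2} \<times> Cl) u" "\<forall>z\<in>{0..a2} \<times> Cl. u z = T u z" by blast
  show ?thesis
  proof (rule that[of "\<lambda>a x. u (a,x)", OF jc_curry[OF u(1)]])
    fix a x assume "a \<in> {0..a2}" "x \<in> Cl"
    then show "u (a,x) = Rop l f g a x + Sop l (\<lambda>a x. u (a,x)) a x"
      using u(2)[rule_format, of "(a,x)"] unfolding T_def by (simp only: mem_Sigma_iff prod.case simp_thms)
  qed
qed

lemma solves_diff:
  assumes s1: "solves l \<phi>1 \<psi>1 f g" and s2: "solves l \<phi>2 \<psi>2 f g"
  shows "solves l (\<lambda>a x. \<phi>1 a x - \<phi>2 a x) (\<lambda>a x. \<psi>1 a x - \<psi>2 a x) (\<lambda>x. 0) (\<lambda>a x. 0)"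
proof -
  have W1: "W11 \<Omega> a2 \<phi>1 \<psi>1" and W2: "W11 \<Omega> a2 \<phi>2 \<psi>2" using s1 s2 by blast+
  have j1: "jc \<phi>1" and j2: "jc \<phi>2"
    using W11_continuous[OF W1] W11_continuous[OF W2] a2_pos by auto
  have L1: "\<psi>1 \<in> L1sp \<Omega> a2" and L2: "\<psi>2 \<in> L1sp \<Omega> a2" using W1 W2 unfolding W11_def by blast+
  have "(\<lambda>a x. \<psi>1 a x - \<psi>2 a x) \<in> L1sp \<Omega> a2"
  proof (rule L1spI[where B="\<lambda>a. supOm \<Omega> (\<psi>1 a) + supOm \<Omega> (\<psi>2 a)"])
    show "AE a in MI a2. \<forall>x\<in>Cl. norm (\<psi>1 a x - \<psi>2 a x) \<le> supOm \<Omega> (\<psi>1 a) + supOm \<Omega> (\<psi>2 a)"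
      by (intro AE_I2 ballI order_trans[OF norm_triangle_ineq4] add_mono norm_le_supOm L1spD(1)[OF L1] L1spD(1)[OF L2]) auto
  qed (use L1spD(1,2,3)[OF L1] L1spD(1,2,3)[OF L2] in \<open>auto intro!: continuous_on_diff\<close>)
  moreover have "AC a2 (\<lambda>a. \<phi>1 a x - \<phi>2 a x) (\<lambda>s. \<psi>1 s x - \<psi>2 s x)" if "x \<in> Cl" for x
    using AC_add[OF W11_AC[OF W1 that] AC_cmult[OF W11_AC[OF W2 that], of "- 1"]] by simp
  ultimately have W: "W11 \<Omega> a2 (\<lambda>a x. \<phi>1 a x - \<phi>2 a x) (\<lambda>a x. \<psi>1 a x - \<psi>2 a x)"
    by (intro W11_I continuous_on_diff continuous_on_slice(1)[OF j1] continuous_on_slice(1)[OF j2])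
  have "res_eq J \<Omega> D (\<lambda>a x. \<beta> a) (\<lambda>a x. \<mu>1 a + \<mu>2 x) a2 l (\<lambda>a x. \<phi>1 a x - \<phi>2 a x) (\<lambda>a x. \<psi>1 a x - \<psi>2 a x) (\<lambda>x. 0) (\<lambda>a x. 0)"
    unfolding res_eq_def
  proof (intro conjI ballI)
    fix x assume x: "x \<in> Cl"
    have "\<phi>1 0 x - (LINT a|MI a2. of_real (\<beta> a) * \<phi>1 a x) = \<phi>2 0 x - (LINT a|MI a2. of_real (\<beta> a) * \<phi>2 a x)"
      using s1 s2 x unfolding res_eq_def by simp
    then show "\<phi>1 0 x - \<phi>2 0 x - (LINT a|MI a2. of_real (\<beta> a) * (\<phi>1 a x - \<phi>2 a x)) = 0"
      by (simp add: right_diff_distrib \<beta>\<phi>_integrable[OF j1 x] \<beta>\<phi>_integrable[OF j2 x] algebra_simps)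
  next
    have "AE a in MI a2. \<forall>x\<in>Cl. l * \<phi>1 a x + \<psi>1 a x - of_real D * (Kop J \<Omega> (\<phi>1 a) x - \<phi>1 a x) + of_real (\<mu>1 a + \<mu>2 x) * \<phi>1 a x = g a x"
      "AE a in MI a2. \<forall>x\<in>Cl. l * \<phi>2 a x + \<psi>2 a x - of_real D * (Kop J \<Omega> (\<phi>2 a) x - \<phi>2 a x) + of_real (\<mu>1 a + \<mu>2 x) * \<phi>2 a x = g a x"
      using s1 s2 unfolding res_eq_def by blast+
    then show "AE a in MI a2. \<forall>x\<in>Cl. l * (\<phi>1 a x - \<phi>2 a x) + (\<psi>1 a x - \<psi>2 a x)
        - of_real D * (Kop J \<Omega> (\<lambda>x. \<phi>1 a x - \<phi>2 a x) x - (\<phi>1 a x - \<phi>2 a x)) + of_real (\<mu>1 a + \<mu>2 x) * (\<phi>1 a x - \<phi>2 a x) = 0"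
      using AE_space
    proof eventually_elim
      case (elim a)
      then have a: "a \<in> {0..a2}" by auto
      show ?case
      proof
        fix x assume x: "x \<in> Cl"
        have K: "Kop J \<Omega> (\<lambda>x. \<phi>1 a x - \<phi>2 a x) x = Kop J \<Omega> (\<phi>1 a) x - Kop J \<Omega> (\<phi>2 a) x"
          by (rule Kop_diff[OF continuous_on_slice(1)[OF j1 a] continuous_on_slice(1)[OF j2 a]])
        have "l * (\<phi>1 a x - \<phi>2 a x) + (\<psi>1 a x - \<psi>2 a x)
          - of_real D * (Kop J \<Omega> (\<lambda>x. \<phi>1 a x - \<phi>2 a x) x - (\<phi>1 a x - \<phi>2 a x)) + of_real (\<mu>1 a + \<mu>2 x) * (\<phi>1 a x - \<phi>2 a x)
          = (l * \<phi>1 a x + \<psi>1 a x - of_real D * (Kop J \<Omega> (\<phi>1 a) x - \<phi>1 a x) + of_real (\<mu>1 a + \<mu>2 x) * \<phi>1 a x)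
          - (l * \<phi>2 a x + \<psi>2 a x - of_real D * (Kop J \<Omega> (\<phi>2 a) x - \<phi>2 a x) + of_real (\<mu>1 a + \<mu>2 x) * \<phi>2 a x)"
          unfolding K by (simp add: algebra_simps)
        also have "\<dots> = 0" unfolding elim(1)[rule_format, OF x] elim(2)[rule_format, OF x] by simp
        finally show "l * (\<phi>1 a x - \<phi>2 a x) + (\<psi>1 a x - \<psi>2 a x)
          - of_real D * (Kop J \<Omega> (\<lambda>x. \<phi>1 a x - \<phi>2 a x) x - (\<phi>1 a x - \<phi>2 a x)) + of_real (\<mu>1 a + \<mu>2 x) * (\<phi>1 a x - \<phi>2 a x) = 0" .
      qed
    qed
  qed
  then show ?thesis using W by blast
qed

lemma emeasure_MI: "0 \<le> b \<Longrightarrow> emeasure (MI b) {0<..<b} = ennreal b"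
  by (subst emeasure_restrict_space) auto

lemma zero_L1sp: "(\<lambda>a x. 0) \<in> L1sp \<Omega> a2"
  by (rule L1spI[where B="\<lambda>a. 0"]) auto

lemma resolvent_right_half_plane:
  assumes z0: "F z0 = 1" and l: "z0 + lp < Re l"
  shows "in_resolvent J \<Omega> D (\<lambda>a x. \<beta> a) (\<lambda>a x. \<mu>1 a + \<mu>2 x) a2 l"
proof -
  define t where "t = (Re l - lp + z0) / 2"
  have t: "F t < 1" and tl: "t + lp < Re l"
    using F_strict_antimono[of z0 t] z0 l by (auto simp: t_def field_simps)
  obtain C where C: "0 < C" and bd: "\<And>f g \<phi> a x. continuous_on Cl f \<Longrightarrow> g \<in> L1sp \<Omega> a2 \<Longrightarrow> jc \<phi> \<Longrightarrow>
      (\<And>a x. a \<in> {0..a2} \<Longrightarrow> x \<in> Cl \<Longrightarrow> \<phi> a x = Rop l f g a x + Sop l \<phi> a x) \<Longrightarrow>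
      a \<in> {0..a2} \<Longrightarrow> x \<in> Cl \<Longrightarrow>
      norm (\<phi> a x) \<le> C * (supOm \<Omega> f + (LINT s|MI a2. supOm \<Omega> (g s)))"
    using fixed_point_bound[OF t tl] by metis
  have sol_bd: "norm (\<phi> a x) \<le> C * (supOm \<Omega> f + (LINT s|MI a2. supOm \<Omega> (g s)))"
    if "solves l \<phi> \<psi> f g" "continuous_on Cl f" "g \<in> L1sp \<Omega> a2" "a \<in> {0..a2}" "x \<in> Cl" for f g \<phi> \<psi> a x
    by (rule bd[OF that(2,3) solves_imp_fixed_point[OF that(1,3)] that(4,5)])
  show ?thesis
    unfolding in_resolvent_def
  proof (intro conjI allI ballI impI)
    fix f g assume f: "f \<in> Xsp \<Omega>" and g: "g \<in> L1sp \<Omega> a2"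
    have fc: "continuous_on Cl f" using f by (simp add: Xsp_def)
    obtain \<phi> where \<phi>: "jc \<phi>" "\<And>a x. a \<in> {0..a2} \<Longrightarrow> x \<in> Cl \<Longrightarrow> \<phi> a x = Rop l f g a x + Sop l \<phi> a x"
      using fixed_point_exists[OF t tl fc g] by metis
    from fixed_point_imp_solves[OF \<phi>(1) g \<phi>(2)]
    show "\<exists>\<phi> \<psi>. solves l \<phi> \<psi> f g" by blast
  next
    fix f g \<phi>1 \<psi>1 \<phi>2 \<psi>2 a x
    assume h: "W11 \<Omega> a2 \<phi>1 \<psi>1 \<and> W11 \<Omega> a2 \<phi>2 \<psi>2 \<and>
        res_eq J \<Omega> D (\<lambda>a x. \<beta> a) (\<lambda>a x. \<mu>1 a + \<mu>2 x) a2 l \<phi>1 \<psi>1 f g \<and>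
        res_eq J \<Omega> D (\<lambda>a x. \<beta> a) (\<lambda>a x. \<mu>1 a + \<mu>2 x) a2 l \<phi>2 \<psi>2 f g"
      and a: "a \<in> {0..a2}" and x: "x \<in> Cl"
    have s: "solves l \<phi>1 \<psi>1 f g" "solves l \<phi>2 \<psi>2 f g" using h by blast+
    have "norm (\<phi>1 a x - \<phi>2 a x) \<le> C * (supOm \<Omega> (\<lambda>x. 0) + (LINT s|MI a2. supOm \<Omega> (\<lambda>x. 0)))"
      by (rule sol_bd[OF solves_diff[OF s] continuous_on_const zero_L1sp a x])
    moreover have "supOm \<Omega> (\<lambda>x. 0) = 0" using nonempty_dom by (simp add: supOm_def)
    ultimately show "\<phi>1 a x = \<phi>2 a x" by simp
  next
    show "\<exists>C. \<forall>f\<in>Xsp \<Omega>. \<forall>g\<in>L1sp \<Omega> a2. \<forall>\<phi> \<psi>. solves l \<phi> \<psi> f g \<longrightarrow>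
        (\<integral>\<^sup>+a. ennreal (supOm \<Omega> (\<phi> a)) \<partial>MI a2)
          \<le> ennreal C * (ennreal (supOm \<Omega> f) + (\<integral>\<^sup>+a. ennreal (supOm \<Omega> (g a)) \<partial>MI a2))"
    proof (intro exI[of _ "C * a2"] ballI allI impI)
      fix f g \<phi> \<psi> assume f: "f \<in> Xsp \<Omega>" and g: "g \<in> L1sp \<Omega> a2" and s: "solves l \<phi> \<psi> f g"
      have fc: "continuous_on Cl f" using f by (simp add: Xsp_def)
      define G where "G = (LINT s|MI a2. supOm \<Omega> (g s))"
      have G: "0 \<le> G" unfolding G_def
        by (intro integral_nonneg_AE AE_I2 supOm_nonneg L1spD(1)[OF g]) simp
      have f0: "0 \<le> supOm \<Omega> f" by (rule supOm_nonneg[OF fc])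
      have "(\<integral>\<^sup>+a. ennreal (supOm \<Omega> (\<phi> a)) \<partial>MI a2) \<le> (\<integral>\<^sup>+a. ennreal (C * (supOm \<Omega> f + G)) \<partial>MI a2)"
        unfolding G_def
        by (intro nn_integral_mono ennreal_leI supOm_le sol_bd[OF s fc g]) auto
      also have "\<dots> = ennreal (C * (supOm \<Omega> f + G)) * ennreal a2"
        using a2_pos by (simp add: emeasure_MI)
      also have "\<dots> = ennreal (C * a2) * (ennreal (supOm \<Omega> f) + ennreal G)"
        using C a2_pos f0 G by (simp add: mult_ac flip: ennreal_mult ennreal_plus)
      finally show "(\<integral>\<^sup>+a. ennreal (supOm \<Omega> (\<phi> a)) \<partial>MI a2)
          \<le> ennreal (C * a2) * (ennreal (supOm \<Omega> f) + (\<integral>\<^sup>+a. ennreal (supOm \<Omega> (g a)) \<partial>MI a2))"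
        unfolding L1spD(5)[OF g] G_def .
    qed
  qed
qed

lemma eigenvalue_in_spectrum:
  assumes z0: "F z0 = 1"
  shows "complex_of_real (z0 + lp) \<in> specA J \<Omega> D (\<lambda>a x. \<beta> a) (\<lambda>a x. \<mu>1 a + \<mu>2 x) a2"
proof -
  define e where "e a = exp (complex_of_real (- z0) * of_real a + (- 1) * of_real (RM a))" for a
  define \<phi> where "\<phi> a x = of_real (v x) * e a" for a x
  define \<psi> where "\<psi> a x = of_real (v x) * ((complex_of_real (- z0) + (- 1) * of_real (\<mu>1 a)) * e a)" for a x
  have e_real: "e a = of_real (exp (- z0 * a - RM a))" for a
    by (simp add: e_def flip: exp_of_real)
  have AC_e: "AC a2 e (\<lambda>a. (complex_of_real (- z0) + (- 1) * of_real (\<mu>1 a)) * e a)"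
    unfolding e_def by (intro AC_exp AC_add AC_linear AC_cmult AC_RM)
  have AC: "AC a2 (\<lambda>a. \<phi> a x) (\<lambda>a. \<psi> a x)" for x
    unfolding \<phi>_def \<psi>_def by (rule AC_cmult[OF AC_e])
  obtain V where V: "0 < V" "\<And>x. x \<in> Cl \<Longrightarrow> norm (v x) \<le> V"
    using continuous_on_compact_bound[OF compact_Cl v_cont] by blast
  have L: "\<psi> \<in> L1sp \<Omega> a2"
  proof (rule L1spI[where B="\<lambda>a. V * norm ((complex_of_real (- z0) + (- 1) * of_real (\<mu>1 a)) * e a)"])
    show "continuous_on Cl (\<psi> a)" for a unfolding \<psi>_def by (intro continuous_intros v_cont)
    show "(\<lambda>a. \<psi> a x) \<in> borel_measurable (MI a2)" for x
      by (rule borel_measurable_integrable[OF AC_integrable[OF AC]])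
    show "integrable (MI a2) (\<lambda>a. V * norm ((complex_of_real (- z0) + (- 1) * of_real (\<mu>1 a)) * e a))"
      by (intro integrable_mult_right integrable_norm AC_integrable[OF AC_e])
    show "AE a in MI a2. \<forall>x\<in>Cl. norm (\<psi> a x) \<le> V * norm ((complex_of_real (- z0) + (- 1) * of_real (\<mu>1 a)) * e a)"
      unfolding \<psi>_def norm_mult[of "of_real _"] norm_of_real
      by (intro AE_I2 ballI mult_right_mono) (use V in auto)
  qed
  have W: "W11 \<Omega> a2 \<phi> \<psi>"
    by (rule W11_I[OF L _ AC]) (auto simp: \<phi>_def intro!: continuous_intros v_cont)
  have W0: "W11 \<Omega> a2 (\<lambda>a x. 0) (\<lambda>a x. 0)"
    by (rule W11_I[OF zero_L1sp _ AC_const]) auto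
  have K: "of_real D * Kop J \<Omega> (\<phi> a) x = of_real (lp + D + \<mu>2 x) * \<phi> a x" if "x \<in> Cl" for a x
  proof -
    have "Kop J \<Omega> (\<phi> a) x = e a * Kop J \<Omega> (\<lambda>y. of_real (v y)) x"
      unfolding \<phi>_def mult.commute[of _ "e a"] by (rule Kop_cmult)
    then have "of_real D * Kop J \<Omega> (\<phi> a) x = e a * of_real (D * Kr v x)"
      by (simp add: Kop_of_real mult_ac)
    then show ?thesis unfolding v_eigen[OF that] by (simp add: \<phi>_def mult_ac)
  qed
  have res: "res_eq J \<Omega> D (\<lambda>a x. \<beta> a) (\<lambda>a x. \<mu>1 a + \<mu>2 x) a2 (of_real (z0 + lp)) \<phi> \<psi> (\<lambda>x. 0) (\<lambda>a x. 0)"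
    unfolding res_eq_def
  proof (intro conjI ballI AE_I2)
    fix x assume x: "x \<in> Cl"
    have "(LINT a|MI a2. complex_of_real (\<beta> a) * \<phi> a x)
       = (LINT a|MI a2. complex_of_real (v x) * complex_of_real (\<beta> a * exp (- z0 * a - RM a)))"
      by (rule Bochner_Integration.integral_cong) (simp_all add: \<phi>_def e_real mult_ac)
    also have "\<dots> = of_real (v x) * of_real (F z0)"
      unfolding integral_mult_right_zero integral_complex_of_real F_def ..
    finally show "\<phi> 0 x - (LINT a|MI a2. complex_of_real (\<beta> a) * \<phi> a x) = 0"
      using z0 by (simp add: \<phi>_def e_real RM_0)
  next
    fix a x assume x: "x \<in> Cl"
    have p: "\<psi> a x = (of_real (- z0) - of_real (\<mu>1 a)) * \<phi> a x" by (simp add: \<psi>_def \<phi>_def algebra_simps)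
    show "of_real (z0 + lp) * \<phi> a x + \<psi> a x - of_real D * (Kop J \<Omega> (\<phi> a) x - \<phi> a x) + of_real (\<mu>1 a + \<mu>2 x) * \<phi> a x = 0"
      unfolding right_diff_distrib[of "of_real D"] K[OF x] p by (simp add: algebra_simps)
  qed
  have res0: "res_eq J \<Omega> D (\<lambda>a x. \<beta> a) (\<lambda>a x. \<mu>1 a + \<mu>2 x) a2 (of_real (z0 + lp)) (\<lambda>a x. 0) (\<lambda>a x. 0) (\<lambda>x. 0) (\<lambda>a x. 0)"
    by (simp add: res_eq_def Kop_def)
  obtain x where x: "x \<in> Cl" using nonempty_dom dom_in_Cl by blast
  have "\<phi> 0 x \<noteq> 0" using v_pos[OF x] by (simp add: \<phi>_def e_real)
  moreover have "\<phi> 0 x = 0"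
    if "in_resolvent J \<Omega> D (\<lambda>a x. \<beta> a) (\<lambda>a x. \<mu>1 a + \<mu>2 x) a2 (of_real (z0 + lp))"
    using that[unfolded in_resolvent_def, THEN conjunct2, THEN conjunct1, rule_format, of \<phi> \<psi> "\<lambda>a x. 0" "\<lambda>a x. 0" "\<lambda>x. 0" "\<lambda>a x. 0" 0 x]
      W W0 res res0 x a2_pos by simp
  ultimately show ?thesis unfolding specA_def by blast
qed

lemma sbound_eq:
  assumes "F z0 = 1"
  shows "sbound J \<Omega> D (\<lambda>a x. \<beta> a) (\<lambda>a x. \<mu>1 a + \<mu>2 x) a2 = ereal (z0 + lp)"
proof (rule antisym)
  show "sbound J \<Omega> D (\<lambda>a x. \<beta> a) (\<lambda>a x. \<mu>1 a + \<mu>2 x) a2 \<le> ereal (z0 + lp)"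
    unfolding sbound_def
  proof (rule SUP_least)
    fix l assume "l \<in> specA J \<Omega> D (\<lambda>a x. \<beta> a) (\<lambda>a x. \<mu>1 a + \<mu>2 x) a2"
    then have "\<not> z0 + lp < Re l" using resolvent_right_half_plane[OF assms] by (auto simp: specA_def)
    then show "ereal (Re l) \<le> ereal (z0 + lp)" by simp
  qed
  show "ereal (z0 + lp) \<le> sbound J \<Omega> D (\<lambda>a x. \<beta> a) (\<lambda>a x. \<mu>1 a + \<mu>2 x) a2"
    unfolding sbound_def by (rule SUP_upper2[OF eigenvalue_in_spectrum[OF assms]]) simp
qed

end

lemma (in nonlocal_kernel) principal_eigenvector:
  assumes "has_principal_eigenvalue J \<Omega> D m" "0 < D"
  shows "\<exists>lp v. continuous_on Cl v \<and> (\<forall>x\<in>Cl. 0 < v x) \<and> (\<forall>x\<in>Cl. D * Kr v x = (lp + D + m x) * v x)"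
proof -
  obtain lp v where v: "continuous_on Cl v" "\<forall>x\<in>Cl. 0 \<le> v x" "\<exists>x\<in>Cl. v x \<noteq> 0"
    and e: "\<forall>x\<in>Cl. Lop J \<Omega> D m (\<lambda>y. complex_of_real (v y)) x = complex_of_real (lp * v x)"
    using assms(1) unfolding has_principal_eigenvalue_def by (elim exE conjE) (rule that)
  have eig: "D * Kr v x = (lp + D + m x) * v x" if "x \<in> Cl" for x
  proof -
    have "complex_of_real (D * (Kr v x - v x) - m x * v x) = complex_of_real (lp * v x)"
      using e[rule_format, OF that] unfolding Lop_def Kop_of_real by simp
    then have "D * (Kr v x - v x) - m x * v x = lp * v x" by (simp only: of_real_eq_iff)
    then show ?thesis by (simp add: algebra_simps)
  qed
  have "0 < v x" if "x \<in> Cl" for x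
    by (rule eigenvector_pos[OF v(1) _ v(3) assms(2) eig that]) (use v(2) in blast)+
  then show ?thesis using v(1) eig by blast
qed

theorem mainTheorem16:
  fixes \<Omega> :: "(real^'n) set" and J :: "real^'n \<Rightarrow> real"
    and \<beta> \<mu>1 :: "real \<Rightarrow> real" and \<mu>2 :: "real^'n \<Rightarrow> real"
    and a2 :: real and ahat :: ereal
  assumes "open \<Omega>" and "connected \<Omega>" and "bounded \<Omega>" and "\<Omega> \<noteq> {}"
    and "continuous_on UNIV J" and "\<forall>x. 0 \<le> J x"
    and "\<exists>r. \<forall>x. x \<notin> ball 0 r \<longrightarrow> J x = 0"
    and "0 < J 0" and "integral\<^sup>L lebesgue J = 1"
    and "\<forall>x. J (- x) = J x"
    and "0 < a2" and "ereal a2 < ahat"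
    and "\<forall>a. a2 \<le> a \<and> ereal a < ahat \<longrightarrow> \<beta> a = 0"
    and "\<not> (AE a in lebesgue_on {0<..<a2}. \<beta> a = 0)"
    and "\<beta> \<in> borel_measurable (lebesgue_on {0<..<a2})"
    and "\<exists>M. AE a in lebesgue_on {0<..<a2}. 0 \<le> \<beta> a \<and> \<beta> a \<le> M"
    and "\<mu>1 \<in> borel_measurable (lebesgue_on {0<..<a2})"
    and "\<exists>M. AE a in lebesgue_on {0<..<a2}. 0 \<le> \<mu>1 a \<and> \<mu>1 a \<le> M"
    and "continuous_on (closure \<Omega>) \<mu>2" and "\<forall>x\<in>closure \<Omega>. 0 \<le> \<mu>2 x"
    and "\<exists>c>0. AE a in lebesgue_on {0<..<a2}. \<forall>x\<in>closure \<Omega>. c \<le> \<mu>1 a + \<mu>2 x"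
    and "\<forall>D>0. has_principal_eigenvalue J \<Omega> D \<mu>2"
  shows "\<forall>D1 D2. 0 < D1 \<and> D1 \<le> D2 \<longrightarrow>
     sbound J \<Omega> D2 (\<lambda>a x. \<beta> a) (\<lambda>a x. \<mu>1 a + \<mu>2 x) a2
       \<le> sbound J \<Omega> D1 (\<lambda>a x. \<beta> a) (\<lambda>a x. \<mu>1 a + \<mu>2 x) a2"
proof (intro allI impI, elim conjE)
  fix D1 D2 :: real assume D: "0 < D1" "D1 \<le> D2"
  then have D2: "0 < D2" by simp
  obtain M\<beta> where M\<beta>: "AE a in MI a2. 0 \<le> \<beta> a \<and> \<beta> a \<le> M\<beta>" using assms(16) by blast
  obtain M\<mu> where M\<mu>: "AE a in MI a2. 0 \<le> \<mu>1 a \<and> \<mu>1 a \<le> M\<mu>" using assms(18) by blast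
  interpret age_model \<Omega> J \<beta> \<mu>1 \<mu>2 a2 M\<beta> M\<mu>
    by unfold_locales (use assms(1-6,8-11,14,15,17,19) M\<beta> M\<mu> in simp_all)
  obtain z0 where z0: "F z0 = 1" by (rule F_eq_1)
  obtain l1 v1 where 1: "continuous_on Cl v1" "\<forall>x\<in>Cl. 0 < v1 x"
    "\<forall>x\<in>Cl. D1 * Kr v1 x = (l1 + D1 + \<mu>2 x) * v1 x"
    using principal_eigenvector[OF assms(22)[rule_format, OF D(1)] D(1)] by blast
  obtain l2 v2 where 2: "continuous_on Cl v2" "\<forall>x\<in>Cl. 0 < v2 x"
    "\<forall>x\<in>Cl. D2 * Kr v2 x = (l2 + D2 + \<mu>2 x) * v2 x"
    using principal_eigenvector[OF assms(22)[rule_format, OF D2] D2] by blast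
  interpret E1: age_model_eigen \<Omega> J \<beta> \<mu>1 \<mu>2 a2 M\<beta> M\<mu> D1 l1 v1
    by unfold_locales (rule D(1), rule 1(1), erule 1(2)[rule_format], erule 1(3)[rule_format])
  interpret E2: age_model_eigen \<Omega> J \<beta> \<mu>1 \<mu>2 a2 M\<beta> M\<mu> D2 l2 v2
    by unfold_locales (rule D2, rule 2(1), erule 2(2)[rule_format], erule 2(3)[rule_format])
  have "l2 \<le> l1" 
    by (rule eigenvalue_antimono[OF \<mu>2_cont D E1.v_cont E1.v_pos E2.v_cont E2.v_pos E1.v_eigen E2.v_eigen])
  then show "sbound J \<Omega> D2 (\<lambda>a x. \<beta> a) (\<lambda>a x. \<mu>1 a + \<mu>2 x) a2
       \<le> sbound J \<Omega> D1 (\<lambda>a x. \<beta> a) (\<lambda>a x. \<mu>1 a + \<mu>2 x) a2"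
    unfolding E1.sbound_eq[OF z0] E2.sbound_eq[OF z0] by simp
qed

end
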